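(* Let $n\ge 2$, let $\Phi$ be a radial function on $\mathbb{R}^n$, let $1\le p,\tilde p_1,\tilde p_2<\infty$, and let $\Omega\in L^{\tilde p_2'}(S^{n-1})$. Then, for every $f\in L^{p}_{\rm rad}L^{\tilde p_2}_{\rm ang}(\mathbb{R}^n)$, $$\|H_{\Phi,\Omega}f\|_{L^{p}_{\rm rad}L^{\tilde p_1}_{\rm ang}(\mathbb{R}^n)}\le \omega_{n-1}^{\frac{1}{\tilde p_1}}\,\|\Omega\|_{L^{\tilde p_2'}(S^{n-1})}\int_0^\infty \frac{|\Phi(t)|}{t}\,t^{\frac{n}{p}}\,dt\;\|f\|_{L^{p}_{\rm rad}L^{\tilde p_2}_{\rm ang}(\mathbb{R}^n)} .$$
   Context: $S^{n-1}$ is the unit sphere of $\mathbb{R}^n$ with (unnormalized) surface Lebesgue measure $d\sigma$, and $\omega_{n-1}=\sigma(S^{n-1})$. For $1\le p,\tilde p<\infty$, $$\|f\|_{L^{p}_{\rm rad}L^{\tilde p}_{\rm ang}(\mathbb{R}^n)}=\Big(\int_0^\infty\Big(\int_{S^{n-1}}|f(r\theta)|^{\tilde p}d\sigma(\theta)\Big)^{p/\tilde p}r^{n-1}dr\Big)^{1/p},$$ and the space consists of the measurable $f$ with finite norm. The Hausdorff operator with rough kernel is $$H_{\Phi,\Omega} f(x)=\int_{\mathbb{R}^n}\frac{\Phi(x|y|^{-1})}{|y|^n}f(y)\,\Omega(y')\,dy,\qquad y'=y/|y|,$$ where $\Omega$ is an integrable function on $S^{n-1}$. $\Phi$ is measurable;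 radial means $\Phi(x)$ depends only on $|x|$, and one writes $\Phi(t)$, $t>0$, for its value at points with $|x|=t$. $\tilde p_2'$ is the conjugate exponent: $1/\tilde p_2+1/\tilde p_2'=1$. The inequality has content when the integral constant on the right is finite. *)

theory Defs
  imports "HOL-Probability.Essential_Supremum"
begin

text \<open>
  Positive real powers on \<open>[0,\<infinity>]\<close>; only used with exponent \<open>a > 0\<close>.
\<close>

definition ennpowr :: "ennreal \<Rightarrow> real \<Rightarrow> ennreal" where
  "ennpowr x a = (if x = \<infinity> then \<infinity> else ennreal (enn2real x powr a))"

text \<open>
  Unnormalized surface measure on the unit sphere: \<open>\<sigma>(A) = n |{x. 0 < |x| \<le> 1, x/|x| \<in> A}|\<close>, completed.
  Recall that \<open>sgn x\<close> is \<open>x/|x|\<close>.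
\<close>

definition punctured_ball :: "'a::euclidean_space set" where
  "punctured_ball = {x. x \<noteq> 0 \<and> norm x \<le> 1}"

definition sphere_measure :: "'a::euclidean_space measure" where
  "sphere_measure = completion (scale_measure (of_nat DIM('a))
     (distr (restrict_space lborel punctured_ball) (restrict_space borel (sphere 0 1)) sgn))"

lemma space_sphere_measure: "space (sphere_measure :: 'a::euclidean_space measure) = sphere 0 1"
  by (simp add: sphere_measure_def space_scale_measure space_restrict_space)

lemma sgn_measurable_sphere:
  "sgn \<in> restrict_space lborel (punctured_ball :: 'a::euclidean_space set)
     \<rightarrow>\<^sub>M restrict_space borel (sphere 0 1)"
proof (rule measurable_restrict_space2)
  show "sgn \<in> space (restrict_space lborel (punctured_ball :: 'a set)) \<rightarrow> sphere 0 1"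
    by (auto simp: space_restrict_space punctured_ball_def norm_sgn)
  show "sgn \<in> borel_measurable (restrict_space lborel (punctured_ball :: 'a set))"
    unfolding sgn_div_norm[abs_def] by (intro measurable_restrict_space1) measurable
qed

lemma emeasure_sphere_measure:
  fixes A :: "'a::euclidean_space set"
  assumes "A \<in> sets borel" "A \<subseteq> sphere 0 1"
  shows "emeasure sphere_measure A =
    of_nat DIM('a) * emeasure lborel {x. x \<noteq> 0 \<and> norm x \<le> 1 \<and> sgn x \<in> A}"
proof -
  have pb: "(punctured_ball :: 'a set) \<in> sets borel"
    unfolding punctured_ball_def by measurable
  have A: "A \<in> sets (restrict_space borel (sphere 0 1))"
    using assms by (auto simp: sets_restrict_space_iff)
  have eq: "sgn -` A \<inter> space (restrict_space lborel (punctured_ball :: 'a set))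
      = {x. x \<noteq> 0 \<and> norm x \<le> 1 \<and> sgn x \<in> A}"
    by (auto simp: space_restrict_space punctured_ball_def)
  have "emeasure sphere_measure A = of_nat DIM('a) * emeasure
      (distr (restrict_space lborel punctured_ball) (restrict_space borel (sphere 0 1)) sgn) A"
    using A by (simp add: sphere_measure_def)
  also have "\<dots> = of_nat DIM('a) * emeasure lborel {x. x \<noteq> 0 \<and> norm x \<le> 1 \<and> sgn x \<in> A}"
    unfolding emeasure_distr[OF sgn_measurable_sphere A] eq
    using pb by (subst emeasure_restrict_space) (auto simp: punctured_ball_def)
  finally show ?thesis .
qed

definition sphere_Lnorm :: "ennreal \<Rightarrow> ('a::euclidean_space \<Rightarrow> complex) \<Rightarrow> ennreal" where
  "sphere_Lnorm q \<Omega> =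
    (if q = \<infinity> then esssup sphere_measure (\<lambda>\<theta>. ennreal (norm (\<Omega> \<theta>)))
     else ennpowr (\<integral>\<^sup>+\<theta>. ennreal (norm (\<Omega> \<theta>) powr enn2real q) \<partial>sphere_measure) (1 / enn2real q))"

definition sphere_Lspace :: "ennreal \<Rightarrow> ('a::euclidean_space \<Rightarrow> complex) set" where
  "sphere_Lspace q = {\<Omega> \<in> borel_measurable sphere_measure. sphere_Lnorm q \<Omega> < \<infinity>}"

definition mixed_norm :: "real \<Rightarrow> real \<Rightarrow> ('a::euclidean_space \<Rightarrow> complex) \<Rightarrow> ennreal" where
  "mixed_norm p q f =
    ennpowr (\<integral>\<^sup>+r\<in>{0<..}.
        (ennpowr (\<integral>\<^sup>+\<theta>. ennreal (norm (f (r *\<^sub>R \<theta>)) powr q) \<partial>sphere_measure) (p / q)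
          * ennreal (r ^ (DIM('a) - 1))) \<partial>lebesgue) (1 / p)"

definition mixed_space :: "real \<Rightarrow> real \<Rightarrow> ('a::euclidean_space \<Rightarrow> complex) set" where
  "mixed_space p q = {f \<in> borel_measurable lebesgue. mixed_norm p q f < \<infinity>}"

definition radial :: "('a::euclidean_space \<Rightarrow> complex) \<Rightarrow> bool" where
  "radial \<Phi> \<longleftrightarrow> (\<forall>x y. norm x = norm y \<longrightarrow> \<Phi> x = \<Phi> y)"

text \<open>For radial \<open>\<Phi>\<close> and \<open>t > 0\<close>, the common value of \<open>\<Phi>\<close> on the sphere of radius \<open>t\<close>.\<close>

definition radial_value :: "('a::euclidean_space \<Rightarrow> complex) \<Rightarrow> real \<Rightarrow> complex" where
  "radial_value \<Phi> t = \<Phi> (SOME x. norm x = t)"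

lemma radial_value_norm: "radial \<Phi> \<Longrightarrow> radial_value \<Phi> (norm x) = \<Phi> x"
  unfolding radial_value_def radial_def by (metis (mono_tags, lifting) someI)

definition hausdorff_integrand ::
  "('a::euclidean_space \<Rightarrow> complex) \<Rightarrow> ('a \<Rightarrow> complex) \<Rightarrow> ('a \<Rightarrow> complex) \<Rightarrow> 'a \<Rightarrow> 'a \<Rightarrow> complex" where
  "hausdorff_integrand \<Phi> \<Omega> f x y =
    \<Phi> (x /\<^sub>R norm y) / of_real (norm y ^ DIM('a)) * f y * \<Omega> (sgn y)"

text \<open>As a Bochner integral, this is \<open>0\<close> at points where the integral does not converge absolutely.\<close>

definition hausdorff_op ::
  "('a::euclidean_space \<Rightarrow> complex) \<Rightarrow> ('a \<Rightarrow> complex) \<Rightarrow> ('a \<Rightarrow> complex) \<Rightarrow> 'a \<Rightarrow> complex" where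
  "hausdorff_op \<Phi> \<Omega> f x = (LINT y|lebesgue. hausdorff_integrand \<Phi> \<Omega> f x y)"

definition hausdorff_const :: "real \<Rightarrow> ('a::euclidean_space \<Rightarrow> complex) \<Rightarrow> ennreal" where
  "hausdorff_const p \<Phi> = (\<integral>\<^sup>+t\<in>{0<..}.
     ennreal (norm (radial_value \<Phi> t) / t * t powr (real DIM('a) / p)) \<partial>lebesgue)"

end

theory Submission
  imports Defs
begin

text \<open>
  Since \<open>\<Phi>\<close> is radial, polar coordinates and Hoelder's inequality on the sphere bound \<open>|H f(x)|\<close> by
  a radial function: with \<open>F(s) = \<integral> |f(s\<theta>) \<Omega>(\<theta>)| d\<sigma>(\<theta>)\<close>,
  \<open>|H f(x)| \<le> K(|x|)\<close> where \<open>K(r) = \<integral>\<^sub>0\<^sup>\<infinity> |\<Phi>(r/s)| F(s) ds/s\<close>. This is a multiplicative convolution, so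
  Jensen's inequality for the weight \<open>|\<Phi>(t)| t\<^bsup>n/p-1\<^esup> dt\<close> followed by Tonelli's theorem bounds
  its norm in \<open>L\<^sup>p(r\<^bsup>n-1\<^esup> dr)\<close>; Minkowski's integral inequality is not needed.
\<close>

section \<open>Polar coordinates\<close>

text \<open>The data are measurable only for completed measures, and \<open>\<Phi>\<close> enters
  through the composite y -> x/|y|, whereas Tonelli's theorem asks for joint measurability. So the
  computations use Borel representatives, and the null sets where these differ from the data are
  carried along the maps x -> |x|, x -> sgn x and s -> r/s; this is the purpose of the
  almost-everywhere lemmas.

  The estimates live in [0,\<infinity>], where convergence need not be known beforehand. For x other
  than 0 the absolute integral is exactly K(|x|), so absolute convergence at almost every x is a
  consequence of the norm bound on K.

  The factors of the constant have separate origins: the norm of \<open>\<Omega>\<close> comes from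
  Hoelder's inequality on each sphere, the integral of \<open>\<Phi>\<close> from the convolution on
  the half-line, and \<omega>^(1/p1) is the angular norm of the constant 1, because the majorant K
  is radial.\<close>

text \<open>
  The uncompleted surface measure, carried by the Borel sets of the whole space, so that the product
  measure and Fubini lemmas for Borel functions apply to it.
\<close>

definition sphere_borel :: "'a::euclidean_space measure" where
  "sphere_borel = scale_measure (of_nat DIM('a))
     (distr (restrict_space lborel punctured_ball) borel sgn)"

definition radial_measure :: "nat \<Rightarrow> real measure" where
  "radial_measure n = density lborel (\<lambda>r. ennreal (r ^ (n - 1)) * indicator {0<..} r)"

lemma borel_measurable_sgn [measurable]: "(sgn :: 'a::euclidean_space \<Rightarrow> 'a) \<in> borel_measurable borel"
  unfolding sgn_div_norm[abs_def] by measurable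

lemma punctured_ball_borel [measurable]: "(punctured_ball :: 'a::euclidean_space set) \<in> sets borel"
  unfolding punctured_ball_def by measurable

lemma sets_sphere_borel [measurable_cong, simp]: "sets (sphere_borel :: 'a::euclidean_space measure) = sets borel"
  and space_sphere_borel [simp]: "space (sphere_borel :: 'a::euclidean_space measure) = UNIV"
  by (simp_all add: sphere_borel_def space_scale_measure)

lemma sgn_measurable_punctured_ball [measurable]:
  "(sgn :: 'a::euclidean_space \<Rightarrow> 'a) \<in> borel_measurable (restrict_space lborel punctured_ball)"
  by (intro measurable_restrict_space1) measurable

lemma emeasure_sphere_borel:
  fixes A :: "'a::euclidean_space set"
  assumes A: "A \<in> sets borel"
  shows "emeasure sphere_borel A =
    of_nat DIM('a) * emeasure lborel {x. x \<noteq> 0 \<and> norm x \<le> 1 \<and> sgn x \<in> A}"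
proof -
  have eq: "sgn -` A \<inter> space (restrict_space lborel (punctured_ball :: 'a set))
      = {x. x \<noteq> 0 \<and> norm x \<le> 1 \<and> sgn x \<in> A}"
    by (auto simp: space_restrict_space punctured_ball_def)
  have "emeasure sphere_borel A = of_nat DIM('a) *
      emeasure (distr (restrict_space lborel punctured_ball) borel sgn) A"
    using A by (simp add: sphere_borel_def)
  also have "\<dots> = of_nat DIM('a) * emeasure lborel {x. x \<noteq> 0 \<and> norm x \<le> 1 \<and> sgn x \<in> A}"
    unfolding emeasure_distr[OF sgn_measurable_punctured_ball A] eq
    by (subst emeasure_restrict_space) (auto simp: punctured_ball_def)
  finally show ?thesis .
qed

text \<open>Both measures push the same measure forward along \<open>sgn\<close>; they differ in the
  ambient sigma-algebra and in the completion, and neither affects the integral of a Borel function.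
  This is the bridge between the given norms and Tonelli's theorem.\<close>

lemma nn_integral_sphere_measure:
  fixes g :: "'a::euclidean_space \<Rightarrow> ennreal"
  assumes [measurable]: "g \<in> borel_measurable borel"
  shows "nn_integral sphere_measure g = nn_integral sphere_borel g"
proof -
  have [measurable]: "g \<in> borel_measurable (restrict_space borel (sphere 0 1))"
    by (intro measurable_restrict_space1) simp
  show ?thesis
    unfolding sphere_measure_def sphere_borel_def nn_integral_completion
    by (simp add: nn_integral_scale_measure nn_integral_distr[OF sgn_measurable_sphere] nn_integral_distr)
qed

lemma finite_measure_sphere_borel: "finite_measure (sphere_borel :: 'a::euclidean_space measure)"
proof
  have "emeasure lborel {x::'a. x \<noteq> 0 \<and> norm x \<le> 1} \<le> emeasure lborel (cball (0::'a) 1)"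
    by (intro emeasure_mono) auto
  also have "\<dots> < \<infinity>"
    using emeasure_bounded_finite[OF bounded_cball] by simp
  finally have "emeasure lborel {x::'a. x \<noteq> 0 \<and> norm x \<le> 1} < \<infinity>" .
  then show "emeasure sphere_borel (space (sphere_borel :: 'a measure)) \<noteq> \<infinity>"
    by (simp add: emeasure_sphere_borel ennreal_mult_eq_top_iff)
qed

text \<open>Makes the almost-everywhere filter of the surface measure proper, so that a property of
  almost every direction is attained by some direction.\<close>

lemma emeasure_sphere_borel_UNIV_pos: "emeasure sphere_borel (UNIV :: 'a::euclidean_space set) \<noteq> 0"
proof -
  have "0 < emeasure lborel (ball (0::'a) 1)"
    by (simp add: emeasure_ball)
  also have "\<dots> = emeasure lborel (ball (0::'a) 1 - {0})"
    by (subst emeasure_Diff_null_set) (auto simp: null_sets_def)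
  also have "\<dots> \<le> emeasure lborel {x::'a. x \<noteq> 0 \<and> norm x \<le> 1}"
    by (intro emeasure_mono) auto
  finally show ?thesis
    by (simp add: emeasure_sphere_borel)
qed

section \<open>The radial measure and the product form of Lebesgue measure\<close>

lemma sets_radial_measure [measurable_cong, simp]: "sets (radial_measure n) = sets borel"
  by (simp add: radial_measure_def)

text \<open>Half-lines are stable under intersection and generate the Borel sets. Both the polar
  decomposition and the substitution t = r/s are verified on them.\<close>

lemma measure_eqI_atMost:
  fixes M N :: "real measure"
  assumes "sets M = sets borel" "sets N = sets borel"
    and "\<And>a. emeasure M {..a} = emeasure N {..a}"
    and "\<And>a. emeasure M {..a} < \<infinity>"
  shows "M = N"
proof (rule measure_eqI_generator_eq[where A="\<lambda>i::nat. {..real i}" and \<Omega>=UNIV and E="range atMost"])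
  show "Int_stable (range (atMost :: real \<Rightarrow> _))"
    by (auto simp: Int_stable_def)
  show "sets M = sigma_sets UNIV (range atMost)" "sets N = sigma_sets UNIV (range atMost)"
    unfolding assms(1,2) by (simp_all add: borel_eq_atMost)
  show "(\<Union>i. {..real i}) = UNIV"
    using real_arch_simple by auto
  show "emeasure M {..real i} \<noteq> \<infinity>" for i
    using assms(4)[of "real i"] by simp
qed (use assms(3) in auto)

lemma emeasure_radial_measure_atMost:
  assumes "n > 0"
  shows "emeasure (radial_measure n) {..a} = ennreal (max 0 a ^ n / n)"
proof -
  \<comment> \<open>Adding the null point 0 gives a compact interval for the antiderivative r^n/n;
    for negative \<open>a\<close> the maximum collapses it to {0}.\<close>
  have "emeasure (radial_measure n) {..a} = (\<integral>\<^sup>+r. ennreal (r ^ (n - 1)) * indicator {0..max 0 a} r \<partial>lborel)"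
    unfolding radial_measure_def
    by (subst emeasure_density, simp, simp, intro nn_integral_cong_AE)
       (use AE_lborel_singleton[of "0::real"] in \<open>auto split: split_indicator elim!: eventually_mono\<close>)
  also have "\<dots> = ennreal (max 0 a ^ n / n - 0 ^ n / n)"
    using assms by (intro nn_integral_FTC_Icc) (auto intro!: derivative_eq_intros)
  finally show ?thesis
    using assms by (simp add: zero_power)
qed

lemma sigma_finite_radial_measure:
  assumes "n > 0"
  shows "sigma_finite_measure (radial_measure n)"
proof
  have "(\<Union>i::nat. {..real i}) = UNIV"
    using real_arch_simple by auto
  moreover have "space (radial_measure n) = UNIV"
    by (simp add: radial_measure_def)
  ultimately show "\<exists>A. countable A \<and> A \<subseteq> sets (radial_measure n) \<and> \<Union> A = space (radial_measure n) \<and>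
      (\<forall>a\<in>A. emeasure (radial_measure n) a \<noteq> \<infinity>)"
    using assms
    by (intro exI[of _ "range (\<lambda>i::nat. {..real i})"]) (auto simp: emeasure_radial_measure_atMost)
qed

text \<open>The sector of radius R is the unit sector dilated by R, so its volume carries the factor
  R^n; the surface measure is n times the volume of the unit sector, which leaves R^n/n.\<close>

lemma emeasure_sector:
  fixes B :: "'a::euclidean_space set"
  assumes [measurable]: "B \<in> sets borel"
  shows "emeasure lborel {x. norm x \<le> R \<and> sgn x \<in> B} =
    ennreal (max 0 R ^ DIM('a) / DIM('a)) * emeasure sphere_borel B"
proof -
  define S where "S R = {x::'a. x \<noteq> 0 \<and> norm x \<le> R \<and> sgn x \<in> B}" for R
  have S_meas [measurable]: "S R \<in> sets borel" for R
    unfolding S_def by measurable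
  \<comment> \<open>Since \<open>sgn 0 = 0\<close>, the origin belongs to the sector whenever 0 lies
    in \<open>B\<close> and \<open>R\<close> is nonnegative; it is removed as a null point.\<close>
  have eq: "emeasure lborel {x. norm x \<le> R \<and> sgn x \<in> B} = emeasure lborel (S R)"
  proof (rule emeasure_eq_AE)
    show "AE x in lborel. (x \<in> {x. norm x \<le> R \<and> sgn x \<in> B}) = (x \<in> S R)"
      using AE_lborel_singleton[of "0::'a"] by eventually_elim (auto simp: S_def)
  qed (simp, measurable)
  show ?thesis
  proof (cases "R > 0")
    case True
    have S_iff: "x \<in> S R \<longleftrightarrow> x /\<^sub>R R \<in> S 1" for x
      using True by (auto simp: S_def sgn_scaleR divide_simps)
    have img: "(\<lambda>x. R *\<^sub>R x + 0) ` S 1 = S R"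
    proof (intro set_eqI iffI)
      show "x \<in> S R" if "x \<in> (\<lambda>x. R *\<^sub>R x + 0) ` S 1" for x
        using that True by (auto simp: S_iff)
      show "x \<in> (\<lambda>x. R *\<^sub>R x + 0) ` S 1" if "x \<in> S R" for x
        using that True by (intro image_eqI[of _ _ "x /\<^sub>R R"]) (auto simp flip: S_iff)
    qed
    have "emeasure lborel (S R) = emeasure lebesgue (S R)"
      by simp
    also have "\<dots> = \<bar>R\<bar> ^ DIM('a) * emeasure lebesgue (S 1)"
      unfolding img[symmetric] by (rule emeasure_lebesgue_affine)
    also have "\<dots> = ennreal (R ^ DIM('a) / DIM('a)) * (of_nat DIM('a) * emeasure lebesgue (S 1))"
      using True by (simp add: mult.assoc[symmetric] ennreal_of_nat_eq_real_of_nat ennreal_mult[symmetric])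
    also have "of_nat DIM('a) * emeasure lebesgue (S 1) = emeasure sphere_borel B"
      by (subst emeasure_sphere_borel) (auto simp: S_def)
    finally show ?thesis
      using True eq by simp
  next
    case False
    then have "S R = {}"
      by (auto simp: S_def) (metis norm_le_zero_iff not_less order_trans)
    with False show ?thesis
      unfolding eq by simp
  qed
qed

text \<open>A product measure is determined by rectangles. With the angular side \<open>B\<close>
  fixed, both sides are measures in the radial side \<open>A\<close>, and for a half-line
  \<open>A\<close> the set in question is a sector of known volume.\<close>

lemma distr_lborel_polar:
  "radial_measure DIM('a) \<Otimes>\<^sub>M sphere_borel =
    distr lborel (borel \<Otimes>\<^sub>M borel) (\<lambda>x::'a::euclidean_space. (norm x, sgn x))"
proof (rule pair_measure_eqI)
  interpret S: finite_measure "sphere_borel :: 'a measure"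
    by (rule finite_measure_sphere_borel)
  show "sigma_finite_measure (sphere_borel :: 'a measure)" ..
  show "sigma_finite_measure (radial_measure DIM('a))"
    by (simp add: sigma_finite_radial_measure)
  show "sets (radial_measure DIM('a) \<Otimes>\<^sub>M (sphere_borel :: 'a measure)) =
      sets (distr lborel (borel \<Otimes>\<^sub>M borel) (\<lambda>x::'a. (norm x, sgn x)))"
    by (simp cong: sets_pair_measure_cong)
  fix A :: "real set" and B :: "'a set"
  assume "A \<in> sets (radial_measure DIM('a))" "B \<in> sets sphere_borel"
  then have [measurable]: "A \<in> sets borel" "B \<in> sets borel"
    by simp_all
  let ?M = "scale_measure (emeasure sphere_borel B) (radial_measure DIM('a))"
  let ?N = "distr (restrict_space lborel (sgn -` B)) borel (norm :: 'a \<Rightarrow> real)"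
  have [measurable]: "sgn -` B \<in> sets (borel :: 'a measure)"
    using measurable_sets[OF borel_measurable_sgn, of B] by simp
  have [measurable]: "(norm :: 'a \<Rightarrow> real) \<in> borel_measurable (restrict_space lborel (sgn -` B))"
    by (intro measurable_restrict_space1) simp
  have N: "emeasure ?N A = emeasure lborel {x. norm x \<in> A \<and> sgn x \<in> B}"
    if [measurable]: "A \<in> sets borel" for A
  proof -
    have "emeasure ?N A = emeasure lborel (norm -` A \<inter> sgn -` B)"
      by (subst emeasure_distr) (auto simp: emeasure_restrict_space space_restrict_space)
    also have "norm -` A \<inter> sgn -` B = {x. norm x \<in> A \<and> sgn x \<in> B}"
      by auto
    finally show ?thesis .
  qed
  have "?M = ?N"
  proof (rule measure_eqI_atMost)
    show "emeasure ?M {..a} = emeasure ?N {..a}" for a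
      using N[of "{..a}"]
      by (simp add: emeasure_sector emeasure_radial_measure_atMost mult.commute)
    show "emeasure ?M {..a} < \<infinity>" for a
      by (simp add: emeasure_radial_measure_atMost ennreal_mult_eq_top_iff S.emeasure_finite less_top[symmetric])
  qed simp_all
  then have "emeasure ?M A = emeasure ?N A"
    by simp
  also have "\<dots> = emeasure (distr lborel (borel \<Otimes>\<^sub>M borel) (\<lambda>x::'a. (norm x, sgn x))) (A \<times> B)"
    by (subst N, simp, subst emeasure_distr) (auto intro!: arg_cong[where f="emeasure lborel"])
  finally show "emeasure (radial_measure DIM('a)) A * emeasure sphere_borel B =
      emeasure (distr lborel (borel \<Otimes>\<^sub>M borel) (\<lambda>x::'a. (norm x, sgn x))) (A \<times> B)"
    by (simp add: mult.commute)
qed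

lemma nn_integral_polar_borel:
  fixes g :: "'a::euclidean_space \<Rightarrow> ennreal"
  assumes [measurable]: "g \<in> borel_measurable borel"
  shows "(\<integral>\<^sup>+x. g x \<partial>lborel) =
    (\<integral>\<^sup>+r. (\<integral>\<^sup>+\<theta>. g (r *\<^sub>R \<theta>) \<partial>sphere_borel) \<partial>radial_measure DIM('a))"
proof -
  interpret S: finite_measure "sphere_borel :: 'a measure"
    by (rule finite_measure_sphere_borel)
  have "norm x *\<^sub>R sgn x = x" for x :: 'a
    by (cases "x = 0") (auto simp: sgn_div_norm)
  then have "(\<integral>\<^sup>+x. g x \<partial>lborel) = (\<integral>\<^sup>+x. (\<lambda>(r, \<theta>). g (r *\<^sub>R \<theta>)) (norm x, sgn x) \<partial>lborel)"
    by simp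
  also have "\<dots> = (\<integral>\<^sup>+z. (\<lambda>(r, \<theta>). g (r *\<^sub>R \<theta>)) z
      \<partial>distr lborel (borel \<Otimes>\<^sub>M borel) (\<lambda>x::'a. (norm x, sgn x)))"
    by (subst nn_integral_distr) simp_all
  also have "\<dots> = (\<integral>\<^sup>+r. (\<integral>\<^sup>+\<theta>. g (r *\<^sub>R \<theta>) \<partial>sphere_borel) \<partial>radial_measure DIM('a))"
    unfolding distr_lborel_polar[symmetric]
    by (subst S.nn_integral_fst[symmetric]) (simp_all add: case_prod_beta)
  finally show ?thesis .
qed

lemma nn_integral_polar:
  fixes g :: "'a::euclidean_space \<Rightarrow> ennreal"
  assumes [measurable]: "g \<in> borel_measurable borel"
  shows "(\<integral>\<^sup>+x. g x \<partial>lborel) =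
    (\<integral>\<^sup>+r\<in>{0<..}. ((\<integral>\<^sup>+\<theta>. g (r *\<^sub>R \<theta>) \<partial>sphere_measure) * ennreal (r ^ (DIM('a) - 1))) \<partial>lborel)"
proof -
  interpret S: finite_measure "sphere_borel :: 'a measure"
    by (rule finite_measure_sphere_borel)
  show ?thesis
    unfolding nn_integral_polar_borel[OF assms] radial_measure_def
    by (subst nn_integral_density) (auto simp: nn_integral_sphere_measure mult_ac)
qed

section \<open>Null sets in polar coordinates\<close>

lemma measurable_sphere_measure:
  assumes "f \<in> measurable borel M"
  shows "f \<in> measurable (sphere_measure :: 'a::euclidean_space measure) M"
  unfolding sphere_measure_def using measurable_restrict_space1[OF assms, of "sphere 0 1"]
  by (intro measurable_completion) simp

lemma AE_sphere_borel_norm: "AE \<theta> in (sphere_borel :: 'a::euclidean_space measure). norm \<theta> = 1"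
proof (rule AE_I[where N="{\<theta>. norm \<theta> \<noteq> 1}"])
  have "{x::'a. x \<noteq> 0 \<and> norm x \<le> 1 \<and> sgn x \<in> {\<theta>. norm \<theta> \<noteq> 1}} = {}"
    by (auto simp: norm_sgn)
  then show "emeasure sphere_borel {\<theta>::'a. norm \<theta> \<noteq> 1} = 0"
    by (subst emeasure_sphere_borel) (simp_all only: emeasure_empty mult_zero_right, measurable)
qed (simp_all, measurable)

lemma AE_radial_measure_iff:
  "(AE r in radial_measure n. P r) \<longleftrightarrow> (AE r in lborel. r > 0 \<longrightarrow> P r)"
  unfolding radial_measure_def by (subst AE_density) (auto split: split_indicator intro!: AE_cong)

text \<open>A Borel null set containing the exceptional points has, by Tonelli in either order, null
  slices on almost every sphere and on almost every ray. The second form yields a single good ray,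
  which is what a radial function needs.\<close>

lemma AE_polar:
  fixes P :: "'a::euclidean_space \<Rightarrow> bool"
  assumes "AE x in lborel. P x"
  shows "AE r in lborel. r > 0 \<longrightarrow> (AE \<theta> in sphere_measure. P (r *\<^sub>R \<theta>))"
    and "\<exists>\<theta>. norm \<theta> = 1 \<and> (AE r in lborel. r > 0 \<longrightarrow> P (r *\<^sub>R \<theta>))"
proof -
  interpret S: finite_measure "sphere_borel :: 'a measure"
    by (rule finite_measure_sphere_borel)
  interpret R: sigma_finite_measure "radial_measure DIM('a)"
    by (simp add: sigma_finite_radial_measure)
  interpret pair_sigma_finite "radial_measure DIM('a)" "sphere_borel :: 'a measure" ..
  obtain N where N: "{x. \<not> P x} \<subseteq> N" "emeasure lborel N = 0" and [measurable]: "N \<in> sets borel"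
    using assms by (auto elim!: AE_E)
  have PN: "P x" if "indicator N x = (0::ennreal)" for x
    using N(1) that by (auto split: split_indicator_asm)
  have "(\<integral>\<^sup>+r. (\<integral>\<^sup>+\<theta>. indicator N (r *\<^sub>R \<theta>) \<partial>sphere_borel) \<partial>radial_measure DIM('a)) = 0"
    using N(2) by (subst nn_integral_polar_borel[symmetric]) simp_all
  then have "AE r in radial_measure DIM('a). (\<integral>\<^sup>+\<theta>. indicator N (r *\<^sub>R \<theta>) \<partial>sphere_borel) = (0::ennreal)"
    by (subst (asm) nn_integral_0_iff_AE) simp_all
  moreover have "AE \<theta> in sphere_measure. P (r *\<^sub>R \<theta>)"
    if "(\<integral>\<^sup>+\<theta>. indicator N (r *\<^sub>R \<theta>) \<partial>sphere_borel) = (0::ennreal)" for r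
  proof -
    have "(\<integral>\<^sup>+\<theta>. indicator N (r *\<^sub>R \<theta>) \<partial>sphere_measure) = (0::ennreal)"
      using that by (subst nn_integral_sphere_measure) simp_all
    then have "AE \<theta> in sphere_measure. indicator N (r *\<^sub>R \<theta>) = (0::ennreal)"
      by (subst (asm) nn_integral_0_iff_AE) (auto intro: measurable_sphere_measure)
    then show ?thesis
      by eventually_elim (rule PN)
  qed
  ultimately show "AE r in lborel. r > 0 \<longrightarrow> (AE \<theta> in sphere_measure. P (r *\<^sub>R \<theta>))"
    unfolding AE_radial_measure_iff by (auto elim!: eventually_mono)
  have "(\<integral>\<^sup>+\<theta>. (\<integral>\<^sup>+r. indicator N (r *\<^sub>R \<theta>) \<partial>radial_measure DIM('a)) \<partial>sphere_borel) =
      (\<integral>\<^sup>+r. (\<integral>\<^sup>+\<theta>. indicator N (r *\<^sub>R \<theta>) \<partial>sphere_borel) \<partial>radial_measure DIM('a))"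
    using Fubini[of "\<lambda>(r, \<theta>). indicator N (r *\<^sub>R \<theta>)"] by (simp add: case_prod_beta)
  also have "\<dots> = 0" by fact
  finally have "AE \<theta> in sphere_borel. (\<integral>\<^sup>+r. indicator N (r *\<^sub>R \<theta>) \<partial>radial_measure DIM('a)) = (0::ennreal)"
    by (subst (asm) nn_integral_0_iff_AE) simp_all
  then have "AE \<theta> in sphere_borel. norm \<theta> = 1 \<and>
      (\<integral>\<^sup>+r. indicator N (r *\<^sub>R \<theta>) \<partial>radial_measure DIM('a)) = (0::ennreal)"
    using AE_sphere_borel_norm by eventually_elim simp
  then have "\<exists>\<theta>::'a. norm \<theta> = 1 \<and>
      (\<integral>\<^sup>+r. indicator N (r *\<^sub>R \<theta>) \<partial>radial_measure DIM('a)) = (0::ennreal)"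
    by (rule eventually_happens'[rotated]) (simp add: ae_filter_eq_bot_iff emeasure_sphere_borel_UNIV_pos)
  then obtain \<theta> :: 'a where \<theta>: "norm \<theta> = 1"
    and "(\<integral>\<^sup>+r. indicator N (r *\<^sub>R \<theta>) \<partial>radial_measure DIM('a)) = (0::ennreal)"
    by blast
  from this(2) have "AE r in radial_measure DIM('a). indicator N (r *\<^sub>R \<theta>) = (0::ennreal)"
    by (subst (asm) nn_integral_0_iff_AE) simp_all
  then have "AE r in lborel. r > 0 \<longrightarrow> P (r *\<^sub>R \<theta>)"
    unfolding AE_radial_measure_iff by eventually_elim (auto intro: PN)
  with \<theta> show "\<exists>\<theta>. norm \<theta> = 1 \<and> (AE r in lborel. r > 0 \<longrightarrow> P (r *\<^sub>R \<theta>))"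
    by blast
qed

lemma emeasure_lborel_polar:
  fixes B :: "'a::euclidean_space set"
  assumes [measurable]: "A \<in> sets borel" "B \<in> sets borel"
  shows "emeasure lborel {x. norm x \<in> A \<and> sgn x \<in> B} =
    emeasure (radial_measure DIM('a)) A * emeasure sphere_borel B"
proof -
  interpret S: finite_measure "sphere_borel :: 'a measure"
    by (rule finite_measure_sphere_borel)
  have "emeasure (radial_measure DIM('a)) A * emeasure sphere_borel B =
      emeasure (radial_measure DIM('a) \<Otimes>\<^sub>M sphere_borel) (A \<times> B)"
    by (rule S.emeasure_pair_measure_Times[symmetric]) simp_all
  also have "\<dots> = emeasure lborel {x. norm x \<in> A \<and> sgn x \<in> B}"
    unfolding distr_lborel_polar
    by (subst emeasure_distr) (auto intro!: arg_cong[where f="emeasure lborel"])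
  finally show ?thesis ..
qed

text \<open>The preimage of a radial null set under the norm has measure 0 times the total surface
  measure.\<close>

lemma AE_norm:
  assumes "AE r in lborel. r > 0 \<longrightarrow> P r"
  shows "AE x::'a::euclidean_space in lborel. x \<noteq> 0 \<longrightarrow> P (norm x)"
proof -
  have "AE r in radial_measure DIM('a). r > 0 \<longrightarrow> P r"
    unfolding AE_radial_measure_iff using assms by auto
  then obtain N where N: "{r. \<not> (r > 0 \<longrightarrow> P r)} \<subseteq> N" "emeasure (radial_measure DIM('a)) N = 0"
    and [measurable]: "N \<in> sets borel"
    by (auto elim!: AE_E simp: radial_measure_def)
  show ?thesis
  proof (rule AE_I[where N="{x. norm x \<in> N \<and> sgn x \<in> UNIV}"])
    show "emeasure lborel {x::'a. norm x \<in> N \<and> sgn x \<in> UNIV} = 0"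
      by (subst emeasure_lborel_polar) (simp_all add: N)
  qed (use N(1) in auto)
qed

text \<open>The cone over a null set of directions is the product of the whole half-line with that
  set; its measure vanishes because \<infinity> * 0 = 0 in \<open>ennreal\<close>.\<close>

lemma AE_sgn:
  fixes P :: "'a::euclidean_space \<Rightarrow> bool"
  assumes "AE \<theta> in sphere_measure. P \<theta>"
  shows "AE x in lborel. P (sgn x)"
proof -
  obtain N where N: "{\<theta>\<in>sphere 0 1. \<not> P \<theta>} \<subseteq> N" "N \<subseteq> sphere 0 1" and [measurable]: "N \<in> sets borel"
    and N0: "emeasure sphere_measure N = 0"
    using assms unfolding sphere_measure_def AE_completion_iff
    by (elim AE_E) (auto simp: space_scale_measure space_restrict_space sets_restrict_space_iff)
  have "emeasure sphere_borel N = 0"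
    using N0 N(2) by (simp add: emeasure_sphere_measure emeasure_sphere_borel)
  then have "emeasure lborel {x::'a. norm x \<in> UNIV \<and> sgn x \<in> N} = 0"
    by (subst emeasure_lborel_polar) simp_all
  then have "AE x::'a in lborel. sgn x \<notin> N"
    by (intro AE_I[where N="{x. norm x \<in> UNIV \<and> sgn x \<in> N}"]) (auto, measurable)
  moreover have "P \<theta>" if "norm \<theta> = 1" "\<theta> \<notin> N" for \<theta>
    using that N(1) by auto
  ultimately show ?thesis
    using AE_lborel_singleton[of "0::'a"] by (auto simp: norm_sgn elim!: eventually_elim2)
qed

section \<open>Borel representatives of the data\<close>

lemma completion_ex_borel_measurable_complex:
  fixes g :: "'a \<Rightarrow> complex"
  assumes [measurable]: "g \<in> borel_measurable (completion M)"
  shows "\<exists>g'\<in>borel_measurable M. AE x in M. g x = g' x"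
proof -
  have "(\<lambda>x. Re (g x)) \<in> borel_measurable (completion M)" "(\<lambda>x. Im (g x)) \<in> borel_measurable (completion M)"
    by measurable
  from this[THEN completion_ex_borel_measurable_real]
  obtain u v where [measurable]: "u \<in> borel_measurable M" "v \<in> borel_measurable M"
    and *: "AE x in M. Re (g x) = u x" "AE x in M. Im (g x) = v x"
    by blast
  from * have "AE x in M. g x = Complex (u x) (v x)"
    by eventually_elim (simp add: complex_eq_iff)
  then show ?thesis
    by (intro bexI[of _ "\<lambda>x. Complex (u x) (v x)"]) (auto simp: borel_measurable_complex_iff)
qed

text \<open>The surface measure lives on the sphere as a subspace; a representative found there
  becomes Borel on the whole space when extended by zero.\<close>

lemma sphere_measure_ex_borel_measurable:
  fixes g :: "'a::euclidean_space \<Rightarrow> complex"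
  assumes "g \<in> borel_measurable sphere_measure"
  shows "\<exists>g'\<in>borel_measurable borel. AE \<theta> in sphere_measure. g \<theta> = g' \<theta>"
proof -
  define S :: "'a measure" where "S = scale_measure (of_nat DIM('a))
    (distr (restrict_space lborel punctured_ball) (restrict_space borel (sphere 0 1)) sgn)"
  have S: "sphere_measure = completion S"
    by (simp add: sphere_measure_def S_def)
  have sets_S: "sets S = sets (restrict_space borel (sphere 0 1))"
    by (simp add: S_def)
  have "g \<in> borel_measurable (completion S)"
    using assms by (simp only: S)
  from completion_ex_borel_measurable_complex[OF this]
  obtain h where h: "h \<in> borel_measurable (restrict_space borel (sphere 0 1))"
    and gh: "AE \<theta> in sphere_measure. g \<theta> = h \<theta>"
    unfolding S AE_completion_iff measurable_cong_sets[OF sets_S refl] by blast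
  from h have "(\<lambda>\<theta>. indicator (sphere 0 1) \<theta> *\<^sub>R h \<theta>) \<in> borel_measurable borel"
    by (subst (asm) borel_measurable_restrict_space_iff) auto
  moreover have "AE \<theta> in sphere_measure. g \<theta> = indicator (sphere 0 1) \<theta> *\<^sub>R h \<theta>"
    using gh AE_space by eventually_elim (simp add: space_sphere_measure)
  ultimately show ?thesis
    by (intro bexI[of _ "\<lambda>\<theta>. indicator (sphere 0 1) \<theta> *\<^sub>R h \<theta>"])
qed

text \<open>A Borel representative of \<open>\<Phi>\<close> need not be radial, so the profile is
  read off along one ray on which it agrees with \<open>\<Phi>\<close> almost everywhere.\<close>

lemma radial_value_ex_borel_measurable:
  fixes \<Phi> :: "'a::euclidean_space \<Rightarrow> complex"
  assumes "\<Phi> \<in> borel_measurable lebesgue" "radial \<Phi>"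
  shows "\<exists>\<psi>\<in>borel_measurable borel. AE t in lborel. t > 0 \<longrightarrow> radial_value \<Phi> t = \<psi> t"
proof -
  obtain \<Psi> where [measurable]: "\<Psi> \<in> borel_measurable borel" and "AE x in lborel. \<Phi> x = \<Psi> x"
    using completion_ex_borel_measurable_complex[OF assms(1)] by auto
  then obtain \<theta> where \<theta>: "norm \<theta> = 1" "AE r in lborel. r > 0 \<longrightarrow> \<Phi> (r *\<^sub>R \<theta>) = \<Psi> (r *\<^sub>R \<theta>)"
    using AE_polar(2) by blast
  have "radial_value \<Phi> r = \<Phi> (r *\<^sub>R \<theta>)" if "r > 0" for r
    using radial_value_norm[OF assms(2), of "r *\<^sub>R \<theta>"] \<theta>(1) that by simp
  with \<theta>(2) have "AE t in lborel. t > 0 \<longrightarrow> radial_value \<Phi> t = \<Psi> (t *\<^sub>R \<theta>)"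
    by (auto elim!: eventually_mono)
  then show ?thesis
    by (intro bexI[of _ "\<lambda>t. \<Psi> (t *\<^sub>R \<theta>)"]) auto
qed

section \<open>Powers and Hoelder's inequality in the extended nonnegative reals\<close>

lemma ennpowr_ennreal: "0 \<le> x \<Longrightarrow> ennpowr (ennreal x) a = ennreal (x powr a)"
  by (simp add: ennpowr_def)

text \<open>With \<open>0 powr a = 0\<close> for every \<open>a\<close>, the values 0 and
  \<infinity> are fixed by all exponents, even 0 and negative ones. Thanks to this the power laws
  below hold without side conditions.\<close>

lemma ennpowr_top [simp]: "ennpowr top a = top"
  and ennpowr_0 [simp]: "ennpowr 0 a = 0"
  and ennpowr_1 [simp]: "ennpowr x 1 = x"
  by (simp_all add: ennpowr_def less_top)

lemma ennpowr_eq_0_iff [simp]: "ennpowr x a = 0 \<longleftrightarrow> x = 0"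
  by (cases x) (simp_all add: ennpowr_ennreal)

lemma ennpowr_eq_top_iff [simp]: "ennpowr x a = top \<longleftrightarrow> x = top"
  by (cases x) (simp_all add: ennpowr_ennreal)

lemma ennpowr_mono:
  assumes "x \<le> y" "0 \<le> a"
  shows "ennpowr x a \<le> ennpowr y a"
proof (cases y)
  case (real v)
  with assms(1) obtain u where "x = ennreal u" "0 \<le> u" "u \<le> v"
    by (cases x) (auto simp: top_unique)
  with real assms(2) show ?thesis
    by (simp add: ennpowr_ennreal powr_mono2 ennreal_leI)
qed simp

lemma ennpowr_mult: "ennpowr (x * y) a = ennpowr x a * ennpowr y a"
proof (cases "x = 0 \<or> y = 0 \<or> x = top \<or> y = top")
  case True
  then show ?thesis
    by (auto simp: ennreal_mult_eq_top_iff ennreal_mult_top ennreal_top_mult)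
next
  case False
  then obtain u v where "x = ennreal u" "0 \<le> u" "y = ennreal v" "0 \<le> v"
    by (cases x; cases y) auto
  then show ?thesis
    by (simp add: ennpowr_ennreal powr_mult ennreal_mult[symmetric])
qed

lemma ennpowr_ennpowr: "ennpowr (ennpowr x a) b = ennpowr x (a * b)"
  by (cases x) (simp_all add: ennpowr_ennreal powr_powr)

lemma ennpowr_add: "ennpowr x (a + b) = ennpowr x a * ennpowr x b"
  by (cases x) (simp_all add: ennpowr_ennreal powr_add ennreal_mult)

lemma measurable_ennpowr [measurable]:
  assumes [measurable]: "f \<in> borel_measurable M"
  shows "(\<lambda>x. ennpowr (f x) a) \<in> borel_measurable M"
  unfolding ennpowr_def by measurable

section \<open>Young, Hoelder and Jensen inequalities\<close>

lemma Youngs_inequality_ennreal: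
  assumes "p > 1" "q > 1" "1 / p + 1 / q = 1"
  shows "x * y \<le> ennreal (1 / p) * ennpowr x p + ennreal (1 / q) * ennpowr y q"
proof (cases "x = 0 \<or> y = 0 \<or> x = top \<or> y = top")
  case True
  then show ?thesis
    using assms(1,2) by (auto simp: ennreal_mult_top)
next
  case False
  then obtain u v where uv: "x = ennreal u" "0 \<le> u" "y = ennreal v" "0 \<le> v"
    by (cases x; cases y) auto
  have "u * v \<le> u powr p / p + v powr q / q"
    using assms uv by (intro Youngs_inequality) auto
  then have "ennreal (u * v) \<le> ennreal (1 / p * u powr p + 1 / q * v powr q)"
    by (intro ennreal_leI) simp
  also have "\<dots> = ennreal (1 / p) * ennreal (u powr p) + ennreal (1 / q) * ennreal (v powr q)"
    using assms(1,2) by (subst ennreal_plus) (simp_all add: ennreal_mult[symmetric])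
  finally show ?thesis
    using uv by (simp add: ennpowr_ennreal ennreal_mult)
qed

text \<open>Young's inequality is applied to f/a and g/b, where a and b are the two norms, so that
  the right-hand side integrates to 1/p + 1/q = 1. If one norm is 0, the product vanishes almost
  everywhere, even when the other norm is infinite.\<close>

lemma nn_integral_Holder:
  fixes f g :: "'a \<Rightarrow> ennreal"
  assumes [measurable]: "f \<in> borel_measurable M" "g \<in> borel_measurable M"
    and pq: "p > 1" "q > 1" "1 / p + 1 / q = 1"
  shows "(\<integral>\<^sup>+x. f x * g x \<partial>M) \<le>
    ennpowr (\<integral>\<^sup>+x. ennpowr (f x) p \<partial>M) (1 / p) * ennpowr (\<integral>\<^sup>+x. ennpowr (g x) q \<partial>M) (1 / q)"
proof -
  define A where "A = (\<integral>\<^sup>+x. ennpowr (f x) p \<partial>M)"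
  define B where "B = (\<integral>\<^sup>+x. ennpowr (g x) q \<partial>M)"
  consider "A = 0 \<or> B = 0" | "A \<noteq> 0" "B \<noteq> 0" "A = top \<or> B = top"
    | u v where "A = ennreal u" "u > 0" "B = ennreal v" "v > 0"
    by (cases A; cases B) (force simp: less_le)+
  then have "(\<integral>\<^sup>+x. f x * g x \<partial>M) \<le> ennpowr A (1 / p) * ennpowr B (1 / q)"
  proof cases
    case 1
    then have "(AE x in M. f x = 0) \<or> (AE x in M. g x = 0)"
      unfolding A_def B_def by (simp add: nn_integral_0_iff_AE)
    then have "AE x in M. f x * g x = 0"
      by (auto elim!: eventually_mono)
    then have "(\<integral>\<^sup>+x. f x * g x \<partial>M) = 0"
      by (subst nn_integral_0_iff_AE) simp_all
    then show ?thesis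
      by simp
  next
    case 2
    then have "ennpowr A (1 / p) * ennpowr B (1 / q) = top"
      by (auto simp: ennreal_mult_eq_top_iff)
    then show ?thesis
      by simp
  next
    case 3
    define a b where "a = u powr (1 / p)" and "b = v powr (1 / q)"
    have ab: "a > 0" "b > 0" "a powr p = u" "b powr q = v"
      using 3 pq by (simp_all add: a_def b_def powr_powr)
    have "f x * g x \<le> ennreal (a * b) *
        (ennreal (1 / (p * u)) * ennpowr (f x) p + ennreal (1 / (q * v)) * ennpowr (g x) q)" for x
    proof -
      have "f x * g x = ennreal (a * b) * ((ennreal (1 / a) * f x) * (ennreal (1 / b) * g x))"
      proof -
        have "ennreal (a * b) * (ennreal (1 / a) * ennreal (1 / b)) = 1"
          using ab(1,2) by (simp add: ennreal_mult[symmetric])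
        then show ?thesis
          by (metis (no_types, lifting) mult.assoc mult.commute mult.left_commute mult_1)
      qed
      also have "\<dots> \<le> ennreal (a * b) * (ennreal (1 / p) * ennpowr (ennreal (1 / a) * f x) p
          + ennreal (1 / q) * ennpowr (ennreal (1 / b) * g x) q)"
        by (intro mult_left_mono Youngs_inequality_ennreal pq) simp
      also have "\<dots> = ennreal (a * b) *
        (ennreal (1 / (p * u)) * ennpowr (f x) p + ennreal (1 / (q * v)) * ennpowr (g x) q)"
        using ab pq 3
        by (simp add: ennpowr_mult ennpowr_ennreal powr_divide mult.assoc[symmetric] ennreal_mult[symmetric])
      finally show ?thesis .
    qed
    then have "(\<integral>\<^sup>+x. f x * g x \<partial>M) \<le> (\<integral>\<^sup>+x. ennreal (a * b) *
        (ennreal (1 / (p * u)) * ennpowr (f x) p + ennreal (1 / (q * v)) * ennpowr (g x) q) \<partial>M)"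
      by (rule nn_integral_mono)
    also have "\<dots> = ennreal (a * b) * (ennreal (1 / (p * u)) * A + ennreal (1 / (q * v)) * B)"
      by (simp add: nn_integral_cmult nn_integral_add A_def B_def)
    also have "ennreal (1 / (p * u)) * A + ennreal (1 / (q * v)) * B = ennreal (1 / p + 1 / q)"
      using 3 pq by (subst ennreal_plus) (simp_all add: ennreal_mult[symmetric])
    also have "ennreal (a * b) * ennreal (1 / p + 1 / q) = ennpowr A (1 / p) * ennpowr B (1 / q)"
      using 3 pq(3) ab(1,2) by (simp add: ennpowr_ennreal a_def b_def ennreal_mult)
    finally show ?thesis .
  qed
  then show ?thesis
    by (simp add: A_def B_def)
qed

text \<open>Jensen's inequality for the convex function t^p and an unnormalized weight: Hoelder's
  inequality for the splitting w = w^(1/q) w^(1/p), with q conjugate to p. The total mass of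
  \<open>w\<close> appears with exponent p/q = p - 1.\<close>

lemma ennpowr_nn_integral_weighted:
  fixes w v :: "'a \<Rightarrow> ennreal"
  assumes [measurable]: "w \<in> borel_measurable M" "v \<in> borel_measurable M" and p: "1 \<le> p"
  shows "ennpowr (\<integral>\<^sup>+x. w x * v x \<partial>M) p \<le>
    ennpowr (\<integral>\<^sup>+x. w x \<partial>M) (p - 1) * (\<integral>\<^sup>+x. w x * ennpowr (v x) p \<partial>M)"
proof (cases "p = 1")
  \<comment> \<open>Here p = 1, which has no finite conjugate exponent. The factor
    \<open>ennpowr C 0\<close> is 0, \<infinity> or 1 according to \<open>C\<close>; for
    \<open>C = 0\<close> the weight vanishes almost everywhere, so the left side is 0 as
    well.\<close>
  case True
  define C where "C = (\<integral>\<^sup>+x. w x \<partial>M)"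
  consider "C = 0" | "C = top" | u where "C = ennreal u" "u > 0"
    by (cases C) (force simp: less_le)+
  then show ?thesis
  proof cases
    case 1
    then have "AE x in M. w x = 0"
      by (simp add: C_def nn_integral_0_iff_AE)
    then have "AE x in M. w x * v x = 0"
      by eventually_elim simp
    then have "(\<integral>\<^sup>+x. w x * v x \<partial>M) = 0"
      by (subst nn_integral_0_iff_AE) simp_all
    then show ?thesis
      by simp
  next
    case 2
    with True show ?thesis
      by (cases "(\<integral>\<^sup>+x. w x * v x \<partial>M) = 0") (simp_all add: C_def[symmetric] ennreal_top_mult)
  next
    case 3
    with True show ?thesis
      by (simp add: C_def[symmetric] ennpowr_ennreal)
  qed
next
  case False
  define q where "q = p / (p - 1)"
  have pq: "p > 1" "q > 1" "1 / q + 1 / p = 1"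
    using p False by (auto simp: q_def field_simps)
  have split: "w x * v x = ennpowr (w x) (1 / q) * (ennpowr (w x) (1 / p) * v x)" for x
    using ennpowr_add[of "w x" "1 / q" "1 / p"] pq(3) by (simp add: mult.assoc[symmetric])
  have "(\<integral>\<^sup>+x. w x * v x \<partial>M) \<le>
      ennpowr (\<integral>\<^sup>+x. ennpowr (ennpowr (w x) (1 / q)) q \<partial>M) (1 / q) *
      ennpowr (\<integral>\<^sup>+x. ennpowr (ennpowr (w x) (1 / p) * v x) p \<partial>M) (1 / p)"
    unfolding split by (intro nn_integral_Holder pq) measurable
  also have "\<dots> = ennpowr (\<integral>\<^sup>+x. w x \<partial>M) (1 / q) *
      ennpowr (\<integral>\<^sup>+x. w x * ennpowr (v x) p \<partial>M) (1 / p)"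
    using pq by (simp add: ennpowr_ennpowr ennpowr_mult)
  finally have "ennpowr (\<integral>\<^sup>+x. w x * v x \<partial>M) p \<le> ennpowr (ennpowr (\<integral>\<^sup>+x. w x \<partial>M) (1 / q) *
      ennpowr (\<integral>\<^sup>+x. w x * ennpowr (v x) p \<partial>M) (1 / p)) p"
    using pq by (intro ennpowr_mono) simp_all
  also have "\<dots> = ennpowr (\<integral>\<^sup>+x. w x \<partial>M) (p - 1) * (\<integral>\<^sup>+x. w x * ennpowr (v x) p \<partial>M)"
    using pq by (simp add: ennpowr_mult ennpowr_ennpowr q_def)
  finally show ?thesis .
qed

lemma sphere_Holder:
  fixes f \<Omega> :: "'a::euclidean_space \<Rightarrow> complex"
  assumes [measurable]: "f \<in> borel_measurable sphere_measure" "\<Omega> \<in> borel_measurable sphere_measure"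
    and p: "1 \<le> p" and q: "inverse (ennreal p) + inverse q = 1"
  shows "(\<integral>\<^sup>+\<theta>. ennreal (norm (f \<theta>)) * ennreal (norm (\<Omega> \<theta>)) \<partial>sphere_measure) \<le>
    sphere_Lnorm q \<Omega> * ennpowr (\<integral>\<^sup>+\<theta>. ennreal (norm (f \<theta>) powr p) \<partial>sphere_measure) (1 / p)"
proof (cases q)
  case top
  \<comment> \<open>An infinite q has inverse 0, so this is the pairing of the integral norm with
    the essential supremum.\<close>
  with q p have "inverse p = 1"
    by (simp add: inverse_ennreal)
  then have "p = 1"
    by (simp add: field_simps)
  have "(\<integral>\<^sup>+\<theta>. ennreal (norm (f \<theta>)) * ennreal (norm (\<Omega> \<theta>)) \<partial>sphere_measure) \<le>
      (\<integral>\<^sup>+\<theta>. sphere_Lnorm q \<Omega> * ennreal (norm (f \<theta>)) \<partial>sphere_measure)"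
  proof (rule nn_integral_mono_AE)
    show "AE \<theta> in sphere_measure. ennreal (norm (f \<theta>)) * ennreal (norm (\<Omega> \<theta>)) \<le>
        sphere_Lnorm q \<Omega> * ennreal (norm (f \<theta>))"
      using esssup_AE[of "\<lambda>\<theta>. ennreal (norm (\<Omega> \<theta>))" sphere_measure] top
      by (subst mult.commute) (auto simp: sphere_Lnorm_def intro!: mult_right_mono elim!: eventually_mono)
  qed
  also have "\<dots> = sphere_Lnorm q \<Omega> * (\<integral>\<^sup>+\<theta>. ennreal (norm (f \<theta>)) \<partial>sphere_measure)"
    by (rule nn_integral_cmult) measurable
  finally show ?thesis
    using \<open>p = 1\<close> by simp
next
  case (real r)
  \<comment> \<open>\<open>inverse 0\<close> is infinite in \<open>ennreal\<close>, so r = 0 would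
    contradict the conjugacy relation.\<close>
  have "r \<noteq> 0"
    using q real by auto
  with real have r: "q = ennreal r" "r > 0"
    by auto
  have "ennreal (1 / p + 1 / r) = ennreal 1"
    using q p r by (simp add: inverse_ennreal ennreal_plus inverse_eq_divide)
  then have sum: "1 / p + 1 / r = 1"
    using p r by (subst (asm) ennreal_inj) auto
  have "1 / p < 1" "1 / r < 1"
    using sum p r by (smt (verit) divide_pos_pos)+
  then have pr: "p > 1" "r > 1"
    using p r by (simp_all add: divide_simps split: if_splits)
  have "(\<integral>\<^sup>+\<theta>. ennreal (norm (f \<theta>)) * ennreal (norm (\<Omega> \<theta>)) \<partial>sphere_measure) \<le>
      ennpowr (\<integral>\<^sup>+\<theta>. ennpowr (ennreal (norm (f \<theta>))) p \<partial>sphere_measure) (1 / p) *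
      ennpowr (\<integral>\<^sup>+\<theta>. ennpowr (ennreal (norm (\<Omega> \<theta>))) r \<partial>sphere_measure) (1 / r)"
    by (intro nn_integral_Holder pr sum) measurable
  then show ?thesis
    using r by (simp add: sphere_Lnorm_def ennpowr_ennreal mult.commute)
qed

section \<open>Multiplicative convolution on the half-line\<close>

text \<open>For positive a and s, r/s \<le> a holds exactly when s \<ge> r/a, and r/s^2 integrates
  over [r/a, \<infinity>) to a, by the antiderivative -r/s. For a \<le> 0 no positive s
  qualifies.\<close>

lemma distr_inversion:
  assumes r: "r > 0"
  shows "distr (density lborel (\<lambda>s. ennreal (r / s\<^sup>2) * indicator {0<..} s)) borel (\<lambda>s. r / s) =
    density lborel (indicator {0<..})"
    (is "?M = _")
proof -
  have M: "emeasure ?M {..a} = ennreal (max 0 a)" for a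
  proof -
    have "emeasure ?M {..a} = (\<integral>\<^sup>+s. ennreal (r / s\<^sup>2) * indicator {0<..} s * indicator ((\<lambda>s. r / s) -` {..a}) s \<partial>lborel)"
      by (subst emeasure_distr, simp, simp, subst emeasure_density) 
         (simp_all add: measurable_sets_borel[of _ borel])
    also have "\<dots> = ennreal (max 0 a)"
    proof (cases "a > 0")
      case True
      have eq: "ennreal (r / s\<^sup>2) * indicator {0<..} s * indicator ((\<lambda>s. r / s) -` {..a}) s =
          ennreal (r / s\<^sup>2) * indicator {r / a..} s" for s
      proof -
        have "s > 0 \<and> r / s \<le> a \<longleftrightarrow> r / a \<le> s"
        proof (cases "s > 0")
          case True
          with \<open>a > 0\<close> show ?thesis
            by (simp add: pos_divide_le_eq mult.commute)
        next
          case False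
          then show ?thesis
            using divide_pos_pos[OF r \<open>a > 0\<close>] by linarith
        qed
        then show ?thesis
          by (auto split: split_indicator)
      qed
      have "(\<integral>\<^sup>+s. ennreal (r / s\<^sup>2) * indicator {r / a..} s \<partial>lborel) = ennreal (0 - (- r / (r / a)))"
      proof (rule nn_integral_FTC_atLeast)
        show "((\<lambda>x. - r / x) \<longlongrightarrow> 0) at_top"
          by (intro tendsto_divide_0[OF tendsto_const] filterlim_at_top_imp_at_infinity filterlim_ident)
        show "DERIV (\<lambda>x. - r / x) x :> r / x\<^sup>2" if "r / a \<le> x" for x
        proof -
          have "x \<noteq> 0"
            using that r True by (metis divide_pos_pos not_le)
          then show ?thesis
            by (auto intro!: derivative_eq_intros simp: power2_eq_square)
        qed
      qed (use r in auto)
      with True r show ?thesis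
        unfolding eq by simp
    next
      case False
      have eq: "ennreal (r / s\<^sup>2) * indicator {0<..} s * indicator ((\<lambda>s. r / s) -` {..a}) s = 0" for s
        using False divide_pos_pos[OF r, of s] by (auto simp del: zero_less_divide_iff split: split_indicator)
      show ?thesis
        unfolding eq using False by simp
    qed
    finally show ?thesis .
  qed
  \<comment> \<open>Lebesgue measure on the half-line is the radial measure of dimension 1.\<close>
  have N: "emeasure (density lborel (indicator {0<..})) {..a} = ennreal (max 0 a)" for a :: real
    using emeasure_radial_measure_atMost[of 1 a] by (simp add: radial_measure_def)
  show ?thesis
    by (rule measure_eqI_atMost) (simp_all add: M N)
qed

lemma nn_integral_inversion:
  fixes h :: "real \<Rightarrow> ennreal"
  assumes [measurable]: "h \<in> borel_measurable borel" and r: "r > 0"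
  shows "(\<integral>\<^sup>+s\<in>{0<..}. (h (r / s) * ennreal (r / s\<^sup>2)) \<partial>lborel) = (\<integral>\<^sup>+t\<in>{0<..}. h t \<partial>lborel)"
proof -
  have "(\<integral>\<^sup>+t\<in>{0<..}. h t \<partial>lborel) = (\<integral>\<^sup>+t. h t \<partial>density lborel (indicator {0<..}))"
    by (subst nn_integral_density) (simp_all add: mult.commute)
  also have "\<dots> = (\<integral>\<^sup>+s\<in>{0<..}. (h (r / s) * ennreal (r / s\<^sup>2)) \<partial>lborel)"
    unfolding distr_inversion[OF r, symmetric]
    by (subst nn_integral_distr, simp, simp, subst nn_integral_density) (simp_all add: mult_ac)
  finally show ?thesis ..
qed

text \<open>The indicator of the pulled-back null set has integral 0 against the weight r/s^2, which
  is strictly positive on the half-line.\<close>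

lemma AE_inversion:
  fixes r :: real
  assumes "AE t in lborel. t > 0 \<longrightarrow> P t" "r > 0"
  shows "AE s in lborel. s > 0 \<longrightarrow> P (r / s)"
proof -
  obtain N where N: "{t. \<not> (t > 0 \<longrightarrow> P t)} \<subseteq> N" "emeasure lborel N = 0" and [measurable]: "N \<in> sets borel"
    using assms(1) by (auto elim!: AE_E)
  have "(\<integral>\<^sup>+s\<in>{0<..}. (indicator N (r / s) * ennreal (r / s\<^sup>2)) \<partial>lborel) = (\<integral>\<^sup>+t\<in>{0<..}. indicator N t \<partial>lborel)"
    using assms(2) by (intro nn_integral_inversion) simp_all
  also have "\<dots> \<le> (\<integral>\<^sup>+t. indicator N t \<partial>lborel)"
    by (intro nn_integral_mono) (auto split: split_indicator)
  also have "\<dots> = 0"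
    using N(2) by simp
  finally have "AE s in lborel. indicator N (r / s) * ennreal (r / s\<^sup>2) * indicator {0<..} s = 0"
    by (subst (asm) le_zero_eq, subst (asm) nn_integral_0_iff_AE) simp_all
  moreover have "P (r / s)" if "s > 0" "r / s \<notin> N" for s
    using that N(1) divide_pos_pos[OF assms(2) that(1)] by auto
  ultimately show ?thesis
    using assms(2) by (auto split: split_indicator_asm elim!: eventually_mono)
qed

lemma nn_integral_dilation:
  fixes h :: "real \<Rightarrow> ennreal"
  assumes [measurable]: "h \<in> borel_measurable borel" and s: "s > 0"
  shows "(\<integral>\<^sup>+r\<in>{0<..}. (h (r / s) * ennreal (1 / s)) \<partial>lborel) = (\<integral>\<^sup>+t\<in>{0<..}. h t \<partial>lborel)"
proof -
  have "(\<integral>\<^sup>+r\<in>{0<..}. (h (r / s) * ennreal (1 / s)) \<partial>lborel) =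
      ennreal \<bar>s\<bar> * (\<integral>\<^sup>+t. h ((0 + s * t) / s) * ennreal (1 / s) * indicator {0<..} (0 + s * t) \<partial>lborel)"
    using s by (intro nn_integral_real_affine) simp_all
  also have "(\<lambda>t. h ((0 + s * t) / s) * ennreal (1 / s) * indicator {0<..} (0 + s * t)) =
      (\<lambda>t. ennreal (1 / s) * (h t * indicator {0<..} t))"
    using s by (auto simp: fun_eq_iff zero_less_mult_iff mult_ac split: split_indicator)
  also have "ennreal \<bar>s\<bar> * (\<integral>\<^sup>+t. ennreal (1 / s) * (h t * indicator {0<..} t) \<partial>lborel) =
      (ennreal \<bar>s\<bar> * ennreal (1 / s)) * (\<integral>\<^sup>+t\<in>{0<..}. h t \<partial>lborel)"
    by (subst nn_integral_cmult) (simp_all add: mult.assoc)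
  also have "ennreal \<bar>s\<bar> * ennreal (1 / s) = 1"
    using s by (simp add: ennreal_mult[symmetric])
  finally show ?thesis
    by simp
qed

text \<open>
  The factor \<open>(s/r)\<^bsup>n/p\<^esup>\<close> moved from the kernel to \<open>F\<close> turns the kernel into the weight \<open>w(r/s) r/s\<^sup>2\<close>, whose
  integral in \<open>s\<close> is the constant and does not depend on \<open>r\<close>.
\<close>

lemma nn_integral_multiplicative_convolution_bound:
  fixes \<phi> :: "real \<Rightarrow> real" and F :: "real \<Rightarrow> ennreal"
  assumes [measurable]: "\<phi> \<in> borel_measurable borel" "F \<in> borel_measurable borel"
    and \<phi>: "\<And>t. 0 \<le> \<phi> t" and p: "1 \<le> p" and n: "n > 0"
  shows "(\<integral>\<^sup>+r\<in>{0<..}. (ennpowr (\<integral>\<^sup>+s\<in>{0<..}. (ennreal (\<phi> (r / s) / s) * F s) \<partial>lborel) p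
      * ennreal (r ^ (n - 1))) \<partial>lborel) \<le>
    ennpowr (\<integral>\<^sup>+t\<in>{0<..}. ennreal (\<phi> t / t * t powr (real n / p)) \<partial>lborel) p *
      (\<integral>\<^sup>+s\<in>{0<..}. (ennpowr (F s) p * ennreal (s ^ (n - 1))) \<partial>lborel)"
proof -
  define w where "w t = ennreal (\<phi> t / t * t powr (real n / p))" for t
  have [measurable]: "w \<in> borel_measurable borel"
    unfolding w_def by measurable
  define C where "C = (\<integral>\<^sup>+t\<in>{0<..}. w t \<partial>lborel)"
  have bound: "ennpowr (\<integral>\<^sup>+s\<in>{0<..}. (ennreal (\<phi> (r / s) / s) * F s) \<partial>lborel) p \<le>
      ennpowr C (p - 1) * (\<integral>\<^sup>+s\<in>{0<..}. (w (r / s) * ennreal (r / s\<^sup>2) * (ennreal ((s / r) ^ n) * ennpowr (F s) p)) \<partial>lborel)"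
    if r: "r > 0" for r
  proof -
    define W where "W s = w (r / s) * ennreal (r / s\<^sup>2) * indicator {0<..} s" for s
    define v where "v s = ennreal ((s / r) powr (real n / p)) * F s" for s
    \<comment> \<open>The powers (r/s)^(n/p) in \<open>W\<close> and (s/r)^(n/p) in \<open>v\<close>
      cancel, and the factor r/s^2 turns the division by r/s in \<open>w\<close> into the division
      by s of the kernel.\<close>
    have "(\<integral>\<^sup>+s\<in>{0<..}. (ennreal (\<phi> (r / s) / s) * F s) \<partial>lborel) = (\<integral>\<^sup>+s. W s * v s \<partial>lborel)"
    proof (intro nn_integral_cong)
      fix s :: real
      show "ennreal (\<phi> (r / s) / s) * F s * indicator {0<..} s = W s * v s"
      proof (cases "s > 0")
        case True
        have "(r / s) powr (real n / p) * (s / r) powr (real n / p) = 1"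
          using r True by (subst powr_mult[symmetric]) auto
        then have "\<phi> (r / s) / s = \<phi> (r / s) / (r / s) * (r / s) powr (real n / p) * (r / s\<^sup>2) * (s / r) powr (real n / p)"
          using r True by (simp add: power2_eq_square)
        also have "ennreal \<dots> = w (r / s) * ennreal (r / s\<^sup>2) * ennreal ((s / r) powr (real n / p))"
          using r True \<phi> by (simp add: w_def ennreal_mult[symmetric])
        finally show ?thesis
          using True by (simp add: W_def v_def mult.assoc)
      qed (simp add: W_def)
    qed
    also have "ennpowr \<dots> p \<le> ennpowr (\<integral>\<^sup>+s. W s \<partial>lborel) (p - 1) * (\<integral>\<^sup>+s. W s * ennpowr (v s) p \<partial>lborel)"
      unfolding W_def v_def by (intro ennpowr_nn_integral_weighted p) measurable
    also have "(\<integral>\<^sup>+s. W s \<partial>lborel) = C"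
      unfolding W_def C_def by (rule nn_integral_inversion) (use r in simp_all)
    also have "(\<integral>\<^sup>+s. W s * ennpowr (v s) p \<partial>lborel) =
        (\<integral>\<^sup>+s\<in>{0<..}. (w (r / s) * ennreal (r / s\<^sup>2) * (ennreal ((s / r) ^ n) * ennpowr (F s) p)) \<partial>lborel)"
    proof (intro nn_integral_cong)
      fix s :: real
      show "W s * ennpowr (v s) p = w (r / s) * ennreal (r / s\<^sup>2) * (ennreal ((s / r) ^ n) * ennpowr (F s) p) * indicator {0<..} s"
      proof (cases "s > 0")
        case True
        then have "ennpowr (v s) p = ennreal ((s / r) ^ n) * ennpowr (F s) p"
          using r p by (simp add: v_def ennpowr_mult ennpowr_ennreal powr_powr powr_realpow)
        with True show ?thesis
          by (simp add: W_def)
      qed (simp add: W_def)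
    qed
    finally show ?thesis .
  qed
  \<comment> \<open>For fixed s, (r/s^2) (s/r)^n r^(n-1) = s^(n-1)/s: the remaining factor 1/s is
    the Jacobian of the dilation r = s t, and the integral of \<open>w\<close> appears a second
    time.\<close>
  have inner: "(\<integral>\<^sup>+r. w (r / s) * ennreal (r / s\<^sup>2) * (ennreal ((s / r) ^ n) * ennpowr (F s) p) * indicator {0<..} s
      * (ennreal (r ^ (n - 1)) * indicator {0<..} r) \<partial>lborel) =
      C * (ennpowr (F s) p * ennreal (s ^ (n - 1)) * indicator {0<..} s)" for s
  proof (cases "s > 0")
    case True
    have "w (r / s) * ennreal (r / s\<^sup>2) * (ennreal ((s / r) ^ n) * ennpowr (F s) p) * indicator {0<..} s
        * (ennreal (r ^ (n - 1)) * indicator {0<..} r) =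
        (ennpowr (F s) p * ennreal (s ^ (n - 1))) * (w (r / s) * ennreal (1 / s) * indicator {0<..} r)" for r
    proof (cases "r > 0")
      case r: True
      obtain m where m: "n = Suc m"
        using n by (cases n) auto
      have "r / s\<^sup>2 * (s / r) ^ n * r ^ (n - 1) = s ^ (n - 1) * (1 / s)"
        using r True by (simp add: m power2_eq_square power_divide)
      then have "ennreal (r / s\<^sup>2) * ennreal ((s / r) ^ n) * ennreal (r ^ (n - 1)) = ennreal (s ^ (n - 1)) * ennreal (1 / s)"
        using r True by (simp add: ennreal_mult[symmetric])
      with r True show ?thesis
        by (simp add: mult_ac)
    qed simp
    then have "(\<integral>\<^sup>+r. w (r / s) * ennreal (r / s\<^sup>2) * (ennreal ((s / r) ^ n) * ennpowr (F s) p) * indicator {0<..} s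
        * (ennreal (r ^ (n - 1)) * indicator {0<..} r) \<partial>lborel) =
        (ennpowr (F s) p * ennreal (s ^ (n - 1))) * (\<integral>\<^sup>+r\<in>{0<..}. (w (r / s) * ennreal (1 / s)) \<partial>lborel)"
      by (simp add: nn_integral_cmult)
    also have "(\<integral>\<^sup>+r\<in>{0<..}. (w (r / s) * ennreal (1 / s)) \<partial>lborel) = C"
      unfolding C_def by (intro nn_integral_dilation True) simp
    finally show ?thesis
      using True by (simp add: mult_ac)
  qed simp
  have "(\<integral>\<^sup>+r\<in>{0<..}. (ennpowr (\<integral>\<^sup>+s\<in>{0<..}. (ennreal (\<phi> (r / s) / s) * F s) \<partial>lborel) p
      * ennreal (r ^ (n - 1))) \<partial>lborel) \<le>
    (\<integral>\<^sup>+r. ennpowr C (p - 1) * (\<integral>\<^sup>+s\<in>{0<..}. (w (r / s) * ennreal (r / s\<^sup>2) * (ennreal ((s / r) ^ n) * ennpowr (F s) p)) \<partial>lborel)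
      * (ennreal (r ^ (n - 1)) * indicator {0<..} r) \<partial>lborel)"
    using bound
    by (intro nn_integral_mono) (auto simp: mult_right_mono split: split_indicator)
  also have "\<dots> = (\<integral>\<^sup>+r. ennpowr C (p - 1) * (\<integral>\<^sup>+s. w (r / s) * ennreal (r / s\<^sup>2) * (ennreal ((s / r) ^ n) * ennpowr (F s) p)
      * indicator {0<..} s * (ennreal (r ^ (n - 1)) * indicator {0<..} r) \<partial>lborel) \<partial>lborel)"
    by (subst nn_integral_multc) (simp_all add: mult.assoc)
  also have "\<dots> = ennpowr C (p - 1) * (\<integral>\<^sup>+r. (\<integral>\<^sup>+s. w (r / s) * ennreal (r / s\<^sup>2) * (ennreal ((s / r) ^ n) * ennpowr (F s) p)
      * indicator {0<..} s * (ennreal (r ^ (n - 1)) * indicator {0<..} r) \<partial>lborel) \<partial>lborel)"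
    by (rule nn_integral_cmult) measurable
  also have "\<dots> = ennpowr C (p - 1) * (\<integral>\<^sup>+s. (\<integral>\<^sup>+r. w (r / s) * ennreal (r / s\<^sup>2) * (ennreal ((s / r) ^ n) * ennpowr (F s) p)
      * indicator {0<..} s * (ennreal (r ^ (n - 1)) * indicator {0<..} r) \<partial>lborel) \<partial>lborel)"
    by (subst lborel_pair.Fubini') simp_all
  also have "\<dots> = ennpowr C (p - 1) * (C * (\<integral>\<^sup>+s\<in>{0<..}. (ennpowr (F s) p * ennreal (s ^ (n - 1))) \<partial>lborel))"
    unfolding inner by (subst nn_integral_cmult) simp_all
  \<comment> \<open>The exponent p - 1 comes from Jensen's inequality and the last factor
    \<open>C\<close> from integrating in r.\<close>
  also have "\<dots> = ennpowr C p * (\<integral>\<^sup>+s\<in>{0<..}. (ennpowr (F s) p * ennreal (s ^ (n - 1))) \<partial>lborel)"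
    using ennpowr_add[of C "p - 1" 1] by (simp add: mult.assoc)
  finally show ?thesis
    unfolding C_def w_def .
qed

section \<open>The Hausdorff operator\<close>

lemma mixed_norm_cong_AE:
  fixes f g :: "'a::euclidean_space \<Rightarrow> complex"
  assumes "AE x in lborel. f x = g x"
  shows "mixed_norm p q f = mixed_norm p q g"
proof -
  have "AE r in lborel. r > 0 \<longrightarrow> (AE \<theta> in sphere_measure. f (r *\<^sub>R \<theta>) = g (r *\<^sub>R \<theta>))"
    by (rule AE_polar(1)[OF assms])
  then have "AE r in lborel.
      ennpowr (\<integral>\<^sup>+\<theta>. ennreal (norm (f (r *\<^sub>R \<theta>)) powr q) \<partial>sphere_measure) (p / q)
        * ennreal (r ^ (DIM('a) - 1)) * indicator {0<..} r =
      ennpowr (\<integral>\<^sup>+\<theta>. ennreal (norm (g (r *\<^sub>R \<theta>)) powr q) \<partial>sphere_measure) (p / q)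
        * ennreal (r ^ (DIM('a) - 1)) * indicator {0<..} r"
  proof eventually_elim
    case (elim r)
    show ?case
    proof (cases "r > 0")
      case True
      with elim have "(\<integral>\<^sup>+\<theta>. ennreal (norm (f (r *\<^sub>R \<theta>)) powr q) \<partial>sphere_measure) =
          (\<integral>\<^sup>+\<theta>. ennreal (norm (g (r *\<^sub>R \<theta>)) powr q) \<partial>sphere_measure)"
        by (intro nn_integral_cong_AE) (auto elim!: eventually_mono)
      then show ?thesis
        by simp
    qed simp
  qed
  then show ?thesis
    unfolding mixed_norm_def nn_integral_completion by (rule arg_cong[OF nn_integral_cong_AE])
qed

text \<open>On each sphere the majorant is a constant, whose angular norm is that constant times
  \<omega>^(1/q). Only monotonicity of \<open>nn_integral\<close> in \<open>g\<close> enters, so the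
  bound applies before the measurability of the operator has been discussed.\<close>

lemma mixed_norm_le_radial:
  fixes g :: "'a::euclidean_space \<Rightarrow> complex" and k :: "real \<Rightarrow> ennreal"
  assumes le: "\<And>x. x \<noteq> 0 \<Longrightarrow> ennreal (norm (g x)) \<le> k (norm x)"
    and p: "0 < p" and q: "0 < q" and [measurable]: "k \<in> borel_measurable borel"
  shows "mixed_norm p q g \<le> ennpowr (emeasure sphere_measure (sphere (0::'a) 1)) (1 / q) *
    ennpowr (\<integral>\<^sup>+r\<in>{0<..}. (ennpowr (k r) p * ennreal (r ^ (DIM('a) - 1))) \<partial>lborel) (1 / p)"
proof -
  let ?\<omega> = "emeasure sphere_measure (sphere (0::'a) 1)"
  have inner: "ennpowr (\<integral>\<^sup>+\<theta>. ennreal (norm (g (r *\<^sub>R \<theta>)) powr q) \<partial>sphere_measure) (p / q) \<le>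
      ennpowr ?\<omega> (p / q) * ennpowr (k r) p" if r: "r > 0" for r
  proof -
    have "(\<integral>\<^sup>+\<theta>. ennreal (norm (g (r *\<^sub>R \<theta>)) powr q) \<partial>sphere_measure) \<le>
        (\<integral>\<^sup>+\<theta>. ennpowr (k r) q \<partial>(sphere_measure :: 'a measure))"
    proof (rule nn_integral_mono)
      fix \<theta> :: 'a
      assume "\<theta> \<in> space sphere_measure"
      then have "norm \<theta> = 1"
        by (simp add: space_sphere_measure)
      with r have "norm (r *\<^sub>R \<theta>) = r" "r *\<^sub>R \<theta> \<noteq> 0"
        by auto
      then have "ennreal (norm (g (r *\<^sub>R \<theta>))) \<le> k r"
        using le[of "r *\<^sub>R \<theta>"] by simp
      then have "ennpowr (ennreal (norm (g (r *\<^sub>R \<theta>)))) q \<le> ennpowr (k r) q"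
        using q by (intro ennpowr_mono) simp_all
      then show "ennreal (norm (g (r *\<^sub>R \<theta>)) powr q) \<le> ennpowr (k r) q"
        by (simp add: ennpowr_ennreal)
    qed
    also have "\<dots> = ennpowr (k r) q * ?\<omega>"
      by (simp add: space_sphere_measure)
    finally have "ennpowr (\<integral>\<^sup>+\<theta>. ennreal (norm (g (r *\<^sub>R \<theta>)) powr q) \<partial>sphere_measure) (p / q) \<le>
        ennpowr (ennpowr (k r) q * ?\<omega>) (p / q)"
      using p q by (intro ennpowr_mono) simp_all
    also have "\<dots> = ennpowr ?\<omega> (p / q) * ennpowr (k r) p"
      using q by (simp add: ennpowr_mult ennpowr_ennpowr mult.commute)
    finally show ?thesis .
  qed
  have "(\<integral>\<^sup>+r\<in>{0<..}. (ennpowr (\<integral>\<^sup>+\<theta>. ennreal (norm (g (r *\<^sub>R \<theta>)) powr q) \<partial>sphere_measure) (p / q)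
      * ennreal (r ^ (DIM('a) - 1))) \<partial>lborel) \<le>
      (\<integral>\<^sup>+r. ennpowr ?\<omega> (p / q) * (ennpowr (k r) p * ennreal (r ^ (DIM('a) - 1)) * indicator {0<..} r) \<partial>lborel)"
    using inner
    by (intro nn_integral_mono) (auto simp: mult_right_mono mult.assoc[symmetric] split: split_indicator)
  also have "\<dots> = ennpowr ?\<omega> (p / q) *
      (\<integral>\<^sup>+r\<in>{0<..}. (ennpowr (k r) p * ennreal (r ^ (DIM('a) - 1))) \<partial>lborel)"
    by (rule nn_integral_cmult) measurable
  finally have "mixed_norm p q g \<le> ennpowr (ennpowr ?\<omega> (p / q) *
      (\<integral>\<^sup>+r\<in>{0<..}. (ennpowr (k r) p * ennreal (r ^ (DIM('a) - 1))) \<partial>lborel)) (1 / p)"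
    unfolding mixed_norm_def nn_integral_completion using p by (intro ennpowr_mono) simp_all
  then show ?thesis
    using p by (simp add: ennpowr_mult ennpowr_ennpowr)
qed

text \<open>On the sphere of radius s the kernel is constant and \<open>sgn\<close> returns the
  direction, so only f and \<Omega> remain under the angular integral. The Jacobian s^(n-1) against
  the denominator s^n leaves 1/s.\<close>

lemma nn_integral_norm_hausdorff_integrand:
  fixes \<Psi> :: "real \<Rightarrow> complex" and f \<Omega> :: "'a::euclidean_space \<Rightarrow> complex"
  assumes [measurable]: "\<Psi> \<in> borel_measurable borel" "f \<in> borel_measurable borel" "\<Omega> \<in> borel_measurable borel"
  shows "(\<integral>\<^sup>+y. ennreal (norm (\<Psi> (R / norm y) / of_real (norm y ^ DIM('a)) * f y * \<Omega> (sgn y))) \<partial>lborel) =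
    (\<integral>\<^sup>+s\<in>{0<..}. (ennreal (norm (\<Psi> (R / s)) / s) *
      (\<integral>\<^sup>+\<theta>. ennreal (norm (f (s *\<^sub>R \<theta>))) * ennreal (norm (\<Omega> \<theta>)) \<partial>sphere_measure)) \<partial>lborel)"
proof (subst nn_integral_polar, measurable, intro nn_integral_cong)
  fix s :: real
  show "(\<integral>\<^sup>+\<theta>. ennreal (norm (\<Psi> (R / norm (s *\<^sub>R \<theta>)) / of_real (norm (s *\<^sub>R \<theta>) ^ DIM('a)) * f (s *\<^sub>R \<theta>)
        * \<Omega> (sgn (s *\<^sub>R \<theta>)))) \<partial>sphere_measure) * ennreal (s ^ (DIM('a) - 1)) * indicator {0<..} s =
      ennreal (norm (\<Psi> (R / s)) / s) *
      (\<integral>\<^sup>+\<theta>. ennreal (norm (f (s *\<^sub>R \<theta>))) * ennreal (norm (\<Omega> \<theta>)) \<partial>sphere_measure) * indicator {0<..} s"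
  proof (cases "s > 0")
    case True
    have "(\<integral>\<^sup>+\<theta>. ennreal (norm (\<Psi> (R / norm (s *\<^sub>R \<theta>)) / of_real (norm (s *\<^sub>R \<theta>) ^ DIM('a)) * f (s *\<^sub>R \<theta>)
        * \<Omega> (sgn (s *\<^sub>R \<theta>)))) \<partial>sphere_measure) =
      (\<integral>\<^sup>+\<theta>. ennreal (norm (\<Psi> (R / s)) / s ^ DIM('a)) *
        (ennreal (norm (f (s *\<^sub>R \<theta>))) * ennreal (norm (\<Omega> \<theta>))) \<partial>sphere_measure)"
    proof (rule nn_integral_cong)
      fix \<theta> :: 'a
      assume "\<theta> \<in> space sphere_measure"
      then have "norm \<theta> = 1"
        by (simp add: space_sphere_measure)
      then have "norm (s *\<^sub>R \<theta>) = s" "sgn (s *\<^sub>R \<theta>) = \<theta>"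
        using True by (simp_all add: sgn_scaleR sgn_div_norm)
      then show "ennreal (norm (\<Psi> (R / norm (s *\<^sub>R \<theta>)) / of_real (norm (s *\<^sub>R \<theta>) ^ DIM('a)) * f (s *\<^sub>R \<theta>)
          * \<Omega> (sgn (s *\<^sub>R \<theta>)))) =
        ennreal (norm (\<Psi> (R / s)) / s ^ DIM('a)) * (ennreal (norm (f (s *\<^sub>R \<theta>))) * ennreal (norm (\<Omega> \<theta>)))"
        using True by (simp add: norm_mult norm_divide norm_power ennreal_mult[symmetric])
    qed
    also have "\<dots> = ennreal (norm (\<Psi> (R / s)) / s ^ DIM('a)) *
        (\<integral>\<^sup>+\<theta>. ennreal (norm (f (s *\<^sub>R \<theta>))) * ennreal (norm (\<Omega> \<theta>)) \<partial>sphere_measure)"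
      by (intro nn_integral_cmult measurable_sphere_measure) measurable
    finally have 1: "(\<integral>\<^sup>+\<theta>. ennreal (norm (\<Psi> (R / norm (s *\<^sub>R \<theta>)) / of_real (norm (s *\<^sub>R \<theta>) ^ DIM('a)) * f (s *\<^sub>R \<theta>)
        * \<Omega> (sgn (s *\<^sub>R \<theta>)))) \<partial>sphere_measure) = \<dots>" .
    have 2: "ennreal (norm (\<Psi> (R / s)) / s ^ DIM('a)) * ennreal (s ^ (DIM('a) - 1)) =
        ennreal (norm (\<Psi> (R / s)) / s)"
    proof -
      obtain m where m: "DIM('a) = Suc m"
        using DIM_positive[where 'a='a] by (cases "DIM('a)") auto
      have "norm (\<Psi> (R / s)) / s ^ DIM('a) * s ^ (DIM('a) - 1) = norm (\<Psi> (R / s)) / s"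
        using True unfolding m by simp
      then show ?thesis
        using True by (simp add: ennreal_mult[symmetric])
    qed
    show ?thesis
      unfolding 1 2[symmetric] by (simp add: mult_ac)
  qed simp
qed


text \<open>The exponent \<open>p2'\<close> ranges over [0,\<infinity>] so that p2 = 1 is paired
  with the essential supremum. The estimate stands outside the implication because a divergent
  integral gives \<open>hausdorff_op\<close> the value 0, which respects the majorant.\<close>

theorem theorem1p2:
  fixes \<Phi> \<Omega> f :: "'a::euclidean_space \<Rightarrow> complex"
    and p p1 p2 :: real and p2' :: ennreal
  assumes "DIM('a) \<ge> 2"
    and "1 \<le> p" and "1 \<le> p1" and "1 \<le> p2"
    and "inverse (ennreal p2) + inverse p2' = 1"
    and "\<Phi> \<in> borel_measurable lebesgue" and "radial \<Phi>"
    and "\<Omega> \<in> sphere_Lspace p2'"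
    and "f \<in> mixed_space p p2"
  shows "(hausdorff_const p \<Phi> < \<infinity> \<longrightarrow>
           (AE x in lebesgue. integrable lebesgue (hausdorff_integrand \<Phi> \<Omega> f x)) \<and>
           hausdorff_op \<Phi> \<Omega> f \<in> mixed_space p p1) \<and>
         mixed_norm p p1 (hausdorff_op \<Phi> \<Omega> f)
           \<le> ennpowr (emeasure sphere_measure (sphere (0::'a) 1)) (1 / p1)
             * sphere_Lnorm p2' \<Omega> * hausdorff_const p \<Phi> * mixed_norm p p2 f"
proof -
  interpret S: finite_measure "sphere_borel :: 'a measure"
    by (rule finite_measure_sphere_borel)
  define \<omega> where "\<omega> = emeasure sphere_measure (sphere (0::'a) 1)"
  define L where "L = sphere_Lnorm p2' \<Omega>"
  define C where "C = hausdorff_const p \<Phi>"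
  define N where "N = mixed_norm p p2 f"
  have \<Omega>_meas [measurable]: "\<Omega> \<in> borel_measurable sphere_measure" and L: "L < \<infinity>"
    using assms(8) by (simp_all add: sphere_Lspace_def L_def)
  have f_meas: "f \<in> borel_measurable (completion lborel)" and N: "N < \<infinity>"
    using assms(9) by (simp_all add: mixed_space_def N_def)
  obtain \<Psi> where [measurable]: "\<Psi> \<in> borel_measurable borel"
    and \<Psi>: "AE t in lborel. t > 0 \<longrightarrow> radial_value \<Phi> t = \<Psi> t"
    using radial_value_ex_borel_measurable[OF assms(6,7)] by blast
  obtain f' where f'_meas [measurable]: "f' \<in> borel_measurable borel" and f': "AE x in lborel. f x = f' x"
    using completion_ex_borel_measurable_complex[OF f_meas] by auto
  obtain \<Omega>' where [measurable]: "\<Omega>' \<in> borel_measurable borel"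
    and \<Omega>': "AE \<theta> in sphere_measure. \<Omega> \<theta> = \<Omega>' \<theta>"
    using sphere_measure_ex_borel_measurable[OF \<Omega>_meas] by blast
  define F where "F s = (\<integral>\<^sup>+\<theta>. ennreal (norm (f' (s *\<^sub>R \<theta>))) * ennreal (norm (\<Omega>' \<theta>)) \<partial>sphere_measure)" for s
  \<comment> \<open>The parameter integral is measurable in s because \<open>sphere_borel\<close> is
    finite and carries the Borel sets of the whole space.\<close>
  have "F = (\<lambda>s. \<integral>\<^sup>+\<theta>. ennreal (norm (f' (s *\<^sub>R \<theta>))) * ennreal (norm (\<Omega>' \<theta>)) \<partial>sphere_borel)"
    unfolding F_def by (rule ext, rule nn_integral_sphere_measure) measurable
  then have [measurable]: "F \<in> borel_measurable borel"
    by simp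
  define K where "K r = (\<integral>\<^sup>+s\<in>{0<..}. (ennreal (norm (\<Psi> (r / s)) / s) * F s) \<partial>lborel)" for r
  have [measurable]: "K \<in> borel_measurable borel"
    unfolding K_def by measurable
  define g where "g x y = \<Psi> (norm x / norm y) / of_real (norm y ^ DIM('a)) * f' y * \<Omega>' (sgn y)" for x y :: 'a
  have g_meas: "(\<lambda>(x, y). g x y) \<in> borel_measurable (borel \<Otimes>\<^sub>M lborel)"
    unfolding g_def by measurable
  have g_meas' [measurable]: "g x \<in> borel_measurable borel" for x
    unfolding g_def by measurable
  \<comment> \<open>The exceptional set of y depends on x but is null for every x \<noteq> 0, since
    y -> |x|/|y| pulls null sets of the half-line back to null sets.\<close>
  have g_eq: "AE y in lborel. hausdorff_integrand \<Phi> \<Omega> f x y = g x y" if "x \<noteq> 0" for x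
  proof -
    have ae: "AE y::'a in lborel. y \<noteq> 0 \<longrightarrow> radial_value \<Phi> (norm x / norm y) = \<Psi> (norm x / norm y)"
      using that by (intro AE_norm AE_inversion \<Psi>) simp
    have eq: "\<Phi> (x /\<^sub>R norm y) = radial_value \<Phi> (norm x / norm y)" for y :: 'a
      using radial_value_norm[OF assms(7), of "x /\<^sub>R norm y"] by (simp add: divide_inverse mult.commute)
    show ?thesis
      using ae f' AE_sgn[OF \<Omega>'] AE_lborel_singleton[of "0::'a"]
      by eventually_elim (simp add: hausdorff_integrand_def g_def eq)
  qed
  have integrand_meas: "hausdorff_integrand \<Phi> \<Omega> f x \<in> borel_measurable lebesgue" if "x \<noteq> 0" for x
  proof (rule borel_measurable_AE)
    show "g x \<in> borel_measurable lebesgue"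
      by (rule measurable_completion) simp
    show "AE y in lebesgue. g x y = hausdorff_integrand \<Phi> \<Omega> f x y"
      using g_eq[OF that] unfolding AE_completion_iff by (auto elim!: eventually_mono)
  qed
  have K_eq: "(\<integral>\<^sup>+y. ennreal (norm (hausdorff_integrand \<Phi> \<Omega> f x y)) \<partial>lebesgue) = K (norm x)" if "x \<noteq> 0" for x
  proof -
    have "(\<integral>\<^sup>+y. ennreal (norm (hausdorff_integrand \<Phi> \<Omega> f x y)) \<partial>lebesgue) =
        (\<integral>\<^sup>+y. ennreal (norm (g x y)) \<partial>lborel)"
      unfolding nn_integral_completion using g_eq[OF that]
      by (intro nn_integral_cong_AE) (auto elim!: eventually_mono)
    also have "\<dots> = K (norm x)"
      unfolding g_def K_def F_def by (rule nn_integral_norm_hausdorff_integrand) measurable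
    finally show ?thesis .
  qed
  have op_le: "ennreal (norm (hausdorff_op \<Phi> \<Omega> f x)) \<le> K (norm x)" if "x \<noteq> 0" for x
  proof (cases "integrable lebesgue (hausdorff_integrand \<Phi> \<Omega> f x)")
    case True
    then show ?thesis
      using integral_norm_bound_ennreal[OF True] K_eq[OF that] by (simp add: hausdorff_op_def)
  next
    case False
    \<comment> \<open>The Bochner integral of a non-integrable function is 0 by definition, so the
      bound is trivial here.\<close>
    then show ?thesis
      by (simp add: hausdorff_op_def not_integrable_integral_eq)
  qed
  have C_eq: "C = (\<integral>\<^sup>+t\<in>{0<..}. ennreal (norm (\<Psi> t) / t * t powr (real DIM('a) / p)) \<partial>lborel)"
    unfolding C_def hausdorff_const_def nn_integral_completion using \<Psi>
    by (intro nn_integral_cong_AE) (auto split: split_indicator elim!: eventually_mono)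
  have F_le: "F s \<le> L * ennpowr (\<integral>\<^sup>+\<theta>. ennreal (norm (f' (s *\<^sub>R \<theta>)) powr p2) \<partial>sphere_measure) (1 / p2)" for s
  proof -
    \<comment> \<open>\<open>L\<close> is the norm of the given \<open>\<Omega>\<close>, so the
      representative is exchanged for it before Hoelder's inequality is used.\<close>
    have "F s = (\<integral>\<^sup>+\<theta>. ennreal (norm (f' (s *\<^sub>R \<theta>))) * ennreal (norm (\<Omega> \<theta>)) \<partial>sphere_measure)"
      unfolding F_def using \<Omega>' by (intro nn_integral_cong_AE) (auto elim!: eventually_mono)
    also have "\<dots> \<le> L * ennpowr (\<integral>\<^sup>+\<theta>. ennreal (norm (f' (s *\<^sub>R \<theta>)) powr p2) \<partial>sphere_measure) (1 / p2)"
      unfolding L_def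
      by (intro sphere_Holder \<Omega>_meas assms(4,5) measurable_sphere_measure) measurable
    finally show ?thesis .
  qed
  have F_bound: "(\<integral>\<^sup>+s\<in>{0<..}. (ennpowr (F s) p * ennreal (s ^ (DIM('a) - 1))) \<partial>lborel) \<le> ennpowr (L * N) p"
  proof -
    define G where "G s = (\<integral>\<^sup>+\<theta>. ennreal (norm (f' (s *\<^sub>R \<theta>)) powr p2) \<partial>sphere_measure)" for s
    have "G = (\<lambda>s. \<integral>\<^sup>+\<theta>. ennreal (norm (f' (s *\<^sub>R \<theta>)) powr p2) \<partial>sphere_borel)"
      unfolding G_def by (rule ext, rule nn_integral_sphere_measure) measurable
    then have [measurable]: "G \<in> borel_measurable borel"
      by simp
    have "ennpowr (F s) p \<le> ennpowr L p * ennpowr (G s) (p / p2)" for s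
    proof -
      have "ennpowr (F s) p \<le> ennpowr (L * ennpowr (G s) (1 / p2)) p"
        using F_le[of s] assms(2) unfolding G_def by (intro ennpowr_mono) simp_all
      then show ?thesis
        by (simp add: ennpowr_mult ennpowr_ennpowr)
    qed
    then have "(\<integral>\<^sup>+s\<in>{0<..}. (ennpowr (F s) p * ennreal (s ^ (DIM('a) - 1))) \<partial>lborel) \<le>
        (\<integral>\<^sup>+s. ennpowr L p * (ennpowr (G s) (p / p2) * ennreal (s ^ (DIM('a) - 1)) * indicator {0<..} s) \<partial>lborel)"
      by (intro nn_integral_mono) (auto simp: mult_right_mono mult.assoc[symmetric] split: split_indicator)
    also have "\<dots> = ennpowr L p *
        (\<integral>\<^sup>+s\<in>{0<..}. (ennpowr (G s) (p / p2) * ennreal (s ^ (DIM('a) - 1))) \<partial>lborel)"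
      by (rule nn_integral_cmult) measurable
    also have "(\<integral>\<^sup>+s\<in>{0<..}. (ennpowr (G s) (p / p2) * ennreal (s ^ (DIM('a) - 1))) \<partial>lborel) =
        ennpowr (mixed_norm p p2 f') p"
      using assms(2) unfolding mixed_norm_def nn_integral_completion G_def by (simp add: ennpowr_ennpowr)
    also have "mixed_norm p p2 f' = N"
      unfolding N_def by (rule mixed_norm_cong_AE[OF f', symmetric])
    finally show ?thesis
      by (simp add: ennpowr_mult)
  qed
  define J where "J = (\<integral>\<^sup>+r\<in>{0<..}. (ennpowr (K r) p * ennreal (r ^ (DIM('a) - 1))) \<partial>lborel)"
  have "J \<le> ennpowr C p * (\<integral>\<^sup>+s\<in>{0<..}. (ennpowr (F s) p * ennreal (s ^ (DIM('a) - 1))) \<partial>lborel)"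
    unfolding J_def K_def C_eq
    by (rule nn_integral_multiplicative_convolution_bound) (use assms(2) in simp_all)
  also have "\<dots> \<le> ennpowr C p * ennpowr (L * N) p"
    by (intro mult_left_mono F_bound) simp
  finally have J: "J \<le> ennpowr (C * (L * N)) p"
    by (simp add: ennpowr_mult)
  have "mixed_norm p p1 (hausdorff_op \<Phi> \<Omega> f) \<le> ennpowr \<omega> (1 / p1) * ennpowr J (1 / p)"
    unfolding \<omega>_def J_def using assms(2,3) op_le by (intro mixed_norm_le_radial) simp_all
  also have "\<dots> \<le> ennpowr \<omega> (1 / p1) * ennpowr (ennpowr (C * (L * N)) p) (1 / p)"
    using assms(2) by (intro mult_left_mono ennpowr_mono J) simp_all
  also have "\<dots> = ennpowr \<omega> (1 / p1) * L * C * N"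
    using assms(2) by (simp add: ennpowr_ennpowr mult_ac)
  finally have bound: "mixed_norm p p1 (hausdorff_op \<Phi> \<Omega> f) \<le> ennpowr \<omega> (1 / p1) * L * C * N" .
  have "(AE x in lebesgue. integrable lebesgue (hausdorff_integrand \<Phi> \<Omega> f x)) \<and>
      hausdorff_op \<Phi> \<Omega> f \<in> mixed_space p p1" if C: "C < \<infinity>"
  proof
    have "C * (L * N) \<noteq> top"
      using C L N by (auto simp: ennreal_mult_eq_top_iff)
    then have "J \<noteq> \<infinity>"
      using J by (auto simp: top_unique)
    then have "AE r in lborel. ennpowr (K r) p * ennreal (r ^ (DIM('a) - 1)) * indicator {0<..} r \<noteq> \<infinity>"
      unfolding J_def by (intro nn_integral_noteq_infinite) simp_all
    \<comment> \<open>For r > 0 the Jacobian is positive and cannot cancel an infinite value of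
      \<open>K\<close>.\<close>
    then have "AE r in lborel. r > 0 \<longrightarrow> K r \<noteq> top"
      by (auto simp: ennreal_mult_eq_top_iff elim!: eventually_mono)
    from AE_norm[OF this] have "AE x::'a in lborel. x \<noteq> 0 \<longrightarrow> K (norm x) \<noteq> top" .
    then have "AE x in lborel. integrable lebesgue (hausdorff_integrand \<Phi> \<Omega> f x)"
      using AE_lborel_singleton[of "0::'a"]
    proof eventually_elim
      case (elim x)
      then show ?case
        using K_eq[of x] integrand_meas[of x] by (intro integrableI_bounded) (simp_all add: less_top)
    qed
    then show "AE x in lebesgue. integrable lebesgue (hausdorff_integrand \<Phi> \<Omega> f x)"
      unfolding AE_completion_iff .
    \<comment> \<open>The integral of the jointly Borel kernel \<open>g\<close> is measurable in x
      and agrees with the operator at every x except possibly the origin.\<close>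
    have "hausdorff_op \<Phi> \<Omega> f \<in> borel_measurable lebesgue"
    proof (rule borel_measurable_AE)
      show "(\<lambda>x. LINT y|lborel. g x y) \<in> borel_measurable lebesgue"
        by (intro measurable_completion lborel.borel_measurable_lebesgue_integral) (use g_meas in simp)
      have "(LINT y|lborel. g x y) = hausdorff_op \<Phi> \<Omega> f x" if "x \<noteq> 0" for x
      proof -
        have "hausdorff_op \<Phi> \<Omega> f x = (LINT y|lebesgue. g x y)"
          unfolding hausdorff_op_def
        proof (rule integral_cong_AE)
          show "AE y in lebesgue. hausdorff_integrand \<Phi> \<Omega> f x y = g x y"
            using g_eq[OF that] unfolding AE_completion_iff .
        qed (use integrand_meas[OF that] in \<open>simp_all add: measurable_completion\<close>)
        also have "\<dots> = (LINT y|lborel. g x y)"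
          by (rule integral_completion) simp
        finally show ?thesis ..
      qed
      then show "AE x in lebesgue. (LINT y|lborel. g x y) = hausdorff_op \<Phi> \<Omega> f x"
        unfolding AE_completion_iff using AE_lborel_singleton[of "0::'a"] by (auto elim!: eventually_mono)
    qed
    moreover have "mixed_norm p p1 (hausdorff_op \<Phi> \<Omega> f) < \<infinity>"
    proof -
      have "\<omega> = emeasure sphere_borel (sphere (0::'a) 1)"
        unfolding \<omega>_def by (simp add: emeasure_sphere_measure emeasure_sphere_borel)
      then have "\<omega> \<noteq> top"
        using S.emeasure_finite by simp
      with C L N have "ennpowr \<omega> (1 / p1) * L * C * N < \<infinity>"
        by (auto simp: less_top[symmetric] ennreal_mult_eq_top_iff)
      with bound show ?thesis
        by (rule order_le_less_trans)
    qed
    ultimately show "hausdorff_op \<Phi> \<Omega> f \<in> mixed_space p p1"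
      by (simp add: mixed_space_def)
  qed
  with bound show ?thesis
    unfolding \<omega>_def L_def C_def N_def by blast
qed

end
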